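(* Fix $p\in[0,r]$. Under the dominant-strategy bidding assumption (in the second-price auction subgame sellers bid truthfully and the speculator bids $0$ for one of his items while withholding the rest from the auction), there exists a unique perfect Bayesian equilibrium of the second-price-auction speculation game. In the equilibrium, seller $i\in\mathcal I$ accepts the speculator's offer if and only if $v_i<v^*(p)$, where, with $\pi_0:=\int_0^r[1-F(x)]^{N-1}dx$, $$v^*(p)=\begin{cases}0,&p\le\pi_0,\\ \text{the unique solution } v\text{ of } p-v=\int_{v}^r[1-F(x)]^{N-1}dx,&\pi_0<p\le r.\end{cases}$$
   Context: Setting. $N\ge2$ risk-neutral sellers, $\mathcal I=\{1,\dots,N\}$, each own one item; seller $i$'s private value $v_i$ is drawn independently from a CDF $F$ on $[0,1]$ with a density $f$, and $F(0)=0<F(v)$ for all $v\in(0,1]$. An auctioneer buys one item by a reverse second-price auction with reserve price $r\in(0,1]$: the lowest bid not exceeding $r$ wins, and the winner is paid the minimum of $r$ and the lowest competing bid. A seller who sells at price $t$ gets $t-v_i$; without a transaction he gets $0$. A speculator has no item and value $0$ for any item. The second-price-auction speculation game: Stage 1: the speculator offers every seller the price $p$ (fixed here); sellers simultaneously accept or reject. Stage 2: the number of sellers in the auction and whether the speculator participates are announced; the auction is held among the sellers who rejected and the speculator (if he acquired at least one item).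
   Formalization: Literal uniqueness fails, as type v*(p) is indifferent when p≥π₀ and beliefs after zero-probability events are free; so uniqueness is proved for acceptance at almost all values, all bids and Bayes-determined beliefs, and "accepts iff v<v*" in every equilibrium except possibly at v=v*, p≥π₀. *)

theory Defs
  imports "HOL-Probability.Probability" "HOL-Library.Multiset"
begin

text \<open>
  Conventions. The sellers are \<open>{1..N}\<close> and \<open>D\<close> is the law of a single private value. The
  number \<open>n\<close> of sellers in the auction determines whether the speculator participates: he does
  iff \<open>n < N\<close>. Hence \<open>n\<close> alone encodes the public announcement. Bids are nonnegative reals, and
  several lowest bids are equally likely to win.
\<close>


subsection \<open>The reverse second-price auction\<close>

text \<open>
  \<open>Min (insert r (set_mset C))\<close> is the minimum of the reserve price \<open>r\<close> and the lowest bid in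
  \<open>C\<close>; without any bid in \<open>C\<close> it is \<open>r\<close>.
\<close>

definition seller_gain :: "real \<Rightarrow> real \<Rightarrow> real \<Rightarrow> real multiset \<Rightarrow> real" where
  "seller_gain r v b C =
     (if b \<le> r \<and> (\<forall>c\<in>#C. b \<le> c)
      then (Min (insert r (set_mset C)) - v) / (1 + real (count C b)) else 0)"

text \<open>
  \<open>B\<close> are the bids submitted by the speculator, one for each item that he does not withhold, and
  \<open>C\<close> are the bids of the sellers. The bids competing with his lowest bid include his own others.
\<close>

definition speculator_gain :: "real \<Rightarrow> real multiset \<Rightarrow> real multiset \<Rightarrow> real" where
  "speculator_gain r B C =
     (if B = {#} then 0 else
        let b = Min (set_mset B) in
        if b \<le> r \<and> (\<forall>c\<in>#C. b \<le> c)
        then Min (insert r (set_mset (B + C - {#b#})))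
             * (real (count B b) / real (count B b + count C b))
        else 0)"


subsection \<open>Strategies and beliefs\<close>

text \<open>
  The state of a seller after stage 1 is \<open>(v, d)\<close>: his value and whether he accepted.
  \<^item> \<open>accept i v\<close> is the probability with which seller \<open>i\<close> of value \<open>v\<close> accepts.
  \<^item> \<open>bid i v n\<close> is his bid, having rejected, when \<open>n\<close> sellers are in the auction.
  \<^item> \<open>spec_bids A\<close> are the speculator's bids when exactly the sellers in \<open>A\<close> have accepted.
  \<^item> \<open>seller_belief i v n\<close> is the belief of seller \<open>i\<close>, in the auction, about the states of
    the other sellers; \<open>spec_belief A\<close> is the speculator's belief about the states of all sellers.
\<close>

record assessment =
  accept :: "nat \<Rightarrow> real \<Rightarrow> real"
  bid :: "nat \<Rightarrow> real \<Rightarrow> nat \<Rightarrow> real"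
  spec_bids :: "nat set \<Rightarrow> real multiset"
  seller_belief :: "nat \<Rightarrow> real \<Rightarrow> nat \<Rightarrow> (nat \<Rightarrow> real \<times> bool) measure"
  spec_belief :: "nat set \<Rightarrow> (nat \<Rightarrow> real \<times> bool) measure"

definition well_formed :: "nat \<Rightarrow> assessment \<Rightarrow> bool" where
  "well_formed N \<sigma> \<longleftrightarrow>
     (\<forall>i\<in>{1..N}. accept \<sigma> i \<in> borel_measurable borel \<and> (\<forall>v\<in>{0..1}. accept \<sigma> i v \<in> {0..1})) \<and>
     (\<forall>i\<in>{1..N}. \<forall>n\<in>{1..N}. (\<lambda>v. bid \<sigma> i v n) \<in> borel_measurable borel \<and>
        (\<forall>v\<in>{0..1}. 0 \<le> bid \<sigma> i v n)) \<and>
     (\<forall>A. A \<subseteq> {1..N} \<and> A \<noteq> {} \<longrightarrow>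
        size (spec_bids \<sigma> A) \<le> card A \<and> (\<forall>b\<in>#spec_bids \<sigma> A. 0 \<le> b))"

definition acceptors :: "nat set \<Rightarrow> (nat \<Rightarrow> real \<times> bool) \<Rightarrow> nat set" where
  "acceptors J \<omega> = {j\<in>J. snd (\<omega> j)}"

definition rejectors :: "nat set \<Rightarrow> (nat \<Rightarrow> real \<times> bool) \<Rightarrow> nat set" where
  "rejectors J \<omega> = {j\<in>J. \<not> snd (\<omega> j)}"

text \<open>Law of \<open>(v, d)\<close> when \<open>v\<close> has law \<open>D\<close> and, given \<open>v\<close>, acceptance has probability \<open>\<alpha> v\<close>.\<close>

definition state_law :: "real measure \<Rightarrow> (real \<Rightarrow> real) \<Rightarrow> (real \<times> bool) measure" where
  "state_law D \<alpha> = density (D \<Otimes>\<^sub>M count_space UNIV)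
     (\<lambda>(v, d). ennreal (if d then \<alpha> v else 1 - \<alpha> v))"

definition states_law :: "real measure \<Rightarrow> assessment \<Rightarrow> nat set \<Rightarrow> (nat \<Rightarrow> real \<times> bool) measure" where
  "states_law D \<sigma> J = PiM J (\<lambda>j. state_law D (accept \<sigma> j))"


subsection \<open>Payoffs in the game\<close>

text \<open>Number of sellers in the auction if seller \<open>i\<close> rejects and the others are in state \<open>\<omega>\<close>.\<close>

definition auction_size :: "nat \<Rightarrow> nat \<Rightarrow> (nat \<Rightarrow> real \<times> bool) \<Rightarrow> nat" where
  "auction_size N i \<omega> = Suc (card (rejectors ({1..N} - {i}) \<omega>))"

definition seller_bids :: "assessment \<Rightarrow> nat set \<Rightarrow> nat \<Rightarrow> (nat \<Rightarrow> real \<times> bool) \<Rightarrow> real multiset" where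
  "seller_bids \<sigma> J n \<omega> = image_mset (\<lambda>j. bid \<sigma> j (fst (\<omega> j)) n) (mset_set J)"

definition competing_bids :: "nat \<Rightarrow> assessment \<Rightarrow> nat \<Rightarrow> (nat \<Rightarrow> real \<times> bool) \<Rightarrow> real multiset" where
  "competing_bids N \<sigma> i \<omega> =
     (let J = {1..N} - {i}; A = acceptors J \<omega>
      in seller_bids \<sigma> (rejectors J \<omega>) (auction_size N i \<omega>) \<omega>
         + (if A = {} then {#} else spec_bids \<sigma> A))"

text \<open>
  Stage 1: payoff of seller \<open>i\<close> with value \<open>v\<close> who accepts with probability \<open>q\<close> and, after
  rejecting, bids \<open>\<beta> n\<close> when \<open>n\<close> sellers are in the auction.
\<close>

definition stage1_payoff ::
  "real measure \<Rightarrow> nat \<Rightarrow> real \<Rightarrow> real \<Rightarrow> assessment \<Rightarrow> nat \<Rightarrow> real \<Rightarrow> real \<Rightarrow> (nat \<Rightarrow> real) \<Rightarrow> real" where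
  "stage1_payoff D N r p \<sigma> i v q \<beta> =
     q * (p - v) + (1 - q) *
       (\<integral>\<omega>. seller_gain r v (\<beta> (auction_size N i \<omega>)) (competing_bids N \<sigma> i \<omega>)
          \<partial>states_law D \<sigma> ({1..N} - {i}))"

definition stage2_seller_payoff ::
  "nat \<Rightarrow> real \<Rightarrow> assessment \<Rightarrow> nat \<Rightarrow> real \<Rightarrow> nat \<Rightarrow> real \<Rightarrow> real" where
  "stage2_seller_payoff N r \<sigma> i v n b =
     (\<integral>\<omega>. seller_gain r v b (competing_bids N \<sigma> i \<omega>) \<partial>seller_belief \<sigma> i v n)"

text \<open>The prices paid to the sellers in \<open>A\<close> are sunk at stage 2 and are left out.\<close>

definition stage2_spec_payoff ::
  "nat \<Rightarrow> real \<Rightarrow> assessment \<Rightarrow> nat set \<Rightarrow> real multiset \<Rightarrow> real" where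
  "stage2_spec_payoff N r \<sigma> A B =
     (\<integral>\<omega>. speculator_gain r B (seller_bids \<sigma> ({1..N} - A) (card ({1..N} - A)) \<omega>)
        \<partial>spec_belief \<sigma> A)"


subsection \<open>Perfect Bayesian equilibrium\<close>

definition sequentially_rational ::
  "real measure \<Rightarrow> nat \<Rightarrow> real \<Rightarrow> real \<Rightarrow> assessment \<Rightarrow> bool" where
  "sequentially_rational D N r p \<sigma> \<longleftrightarrow>
     (\<forall>i\<in>{1..N}. \<forall>v\<in>{0..1}. \<forall>q\<in>{0..1}. \<forall>\<beta>. (\<forall>n. 0 \<le> \<beta> n) \<longrightarrow>
        stage1_payoff D N r p \<sigma> i v q \<beta>
          \<le> stage1_payoff D N r p \<sigma> i v (accept \<sigma> i v) (bid \<sigma> i v)) \<and>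
     (\<forall>i\<in>{1..N}. \<forall>v\<in>{0..1}. \<forall>n\<in>{1..N}. \<forall>b\<ge>0.
        stage2_seller_payoff N r \<sigma> i v n b
          \<le> stage2_seller_payoff N r \<sigma> i v n (bid \<sigma> i v n)) \<and>
     (\<forall>A. A \<subseteq> {1..N} \<and> A \<noteq> {} \<longrightarrow>
        (\<forall>B. size B \<le> card A \<and> (\<forall>b\<in>#B. 0 \<le> b) \<longrightarrow>
           stage2_spec_payoff N r \<sigma> A B \<le> stage2_spec_payoff N r \<sigma> A (spec_bids \<sigma> A)))"

text \<open>States of the others, respectively of all sellers, compatible with what the player knows.\<close>

definition seller_info :: "nat \<Rightarrow> nat \<Rightarrow> nat \<Rightarrow> (nat \<Rightarrow> real \<times> bool) set" where
  "seller_info N i n =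
     {\<omega> \<in> ({1..N} - {i}) \<rightarrow>\<^sub>E ({0..1} \<times> UNIV). auction_size N i \<omega> = n}"

definition spec_info :: "nat \<Rightarrow> nat set \<Rightarrow> (nat \<Rightarrow> real \<times> bool) set" where
  "spec_info N A = {\<omega> \<in> {1..N} \<rightarrow>\<^sub>E ({0..1} \<times> UNIV). acceptors {1..N} \<omega> = A}"

text \<open>
  A belief is a probability measure concentrated on the information set \<open>E\<close>. It is given by Bayes'
  rule (\<open>uniform_measure P E\<close> is \<open>P\<close> conditioned on \<open>E\<close>) whenever \<open>E\<close> has positive probability.
\<close>

definition bayes_belief ::
  "nat set \<Rightarrow> (nat \<Rightarrow> real \<times> bool) measure \<Rightarrow> (nat \<Rightarrow> real \<times> bool) set
     \<Rightarrow> (nat \<Rightarrow> real \<times> bool) measure \<Rightarrow> bool" where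
  "bayes_belief J P E \<mu> \<longleftrightarrow>
     prob_space \<mu> \<and> sets \<mu> = sets (PiM J (\<lambda>_. borel \<Otimes>\<^sub>M count_space UNIV)) \<and>
     measure \<mu> E = 1 \<and> (0 < measure P E \<longrightarrow> \<mu> = uniform_measure P E)"

text \<open>
  The own decision of seller \<open>i\<close> carries no information about the others, so his beliefs
  condition only on the behaviour of the others.
\<close>

definition consistent_beliefs :: "real measure \<Rightarrow> nat \<Rightarrow> assessment \<Rightarrow> bool" where
  "consistent_beliefs D N \<sigma> \<longleftrightarrow>
     (\<forall>i\<in>{1..N}. \<forall>v\<in>{0..1}. \<forall>n\<in>{1..N}.
        bayes_belief ({1..N} - {i}) (states_law D \<sigma> ({1..N} - {i})) (seller_info N i n)
          (seller_belief \<sigma> i v n)) \<and>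
     (\<forall>A. A \<subseteq> {1..N} \<and> A \<noteq> {} \<longrightarrow>
        bayes_belief {1..N} (states_law D \<sigma> {1..N}) (spec_info N A) (spec_belief \<sigma> A))"

definition perfect_bayesian_equilibrium ::
  "real measure \<Rightarrow> nat \<Rightarrow> real \<Rightarrow> real \<Rightarrow> assessment \<Rightarrow> bool" where
  "perfect_bayesian_equilibrium D N r p \<sigma> \<longleftrightarrow>
     well_formed N \<sigma> \<and> sequentially_rational D N r p \<sigma> \<and> consistent_beliefs D N \<sigma>"

definition dominant_strategy_bidding :: "nat \<Rightarrow> assessment \<Rightarrow> bool" where
  "dominant_strategy_bidding N \<sigma> \<longleftrightarrow>
     (\<forall>i\<in>{1..N}. \<forall>v\<in>{0..1}. \<forall>n\<in>{1..N}. bid \<sigma> i v n = v) \<and>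
     (\<forall>A. A \<subseteq> {1..N} \<and> A \<noteq> {} \<longrightarrow> spec_bids \<sigma> A = {#0#})"

text \<open>
  Identification of assessments for the uniqueness claim: same acceptance decisions for almost all
  values, same bids everywhere, same beliefs wherever Bayes' rule determines them.
\<close>

definition same_equilibrium :: "real measure \<Rightarrow> nat \<Rightarrow> assessment \<Rightarrow> assessment \<Rightarrow> bool" where
  "same_equilibrium D N \<sigma> \<tau> \<longleftrightarrow>
     (\<forall>i\<in>{1..N}. AE v in D. accept \<sigma> i v = accept \<tau> i v) \<and>
     (\<forall>i\<in>{1..N}. \<forall>v\<in>{0..1}. \<forall>n\<in>{1..N}. bid \<sigma> i v n = bid \<tau> i v n) \<and>
     (\<forall>A. A \<subseteq> {1..N} \<and> A \<noteq> {} \<longrightarrow> spec_bids \<sigma> A = spec_bids \<tau> A) \<and>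
     (\<forall>i\<in>{1..N}. \<forall>v\<in>{0..1}. \<forall>n\<in>{1..N}.
        0 < measure (states_law D \<sigma> ({1..N} - {i})) (seller_info N i n) \<longrightarrow>
        seller_belief \<sigma> i v n = seller_belief \<tau> i v n) \<and>
     (\<forall>A. A \<subseteq> {1..N} \<and> A \<noteq> {} \<and> 0 < measure (states_law D \<sigma> {1..N}) (spec_info N A) \<longrightarrow>
        spec_belief \<sigma> A = spec_belief \<tau> A)"


subsection \<open>The acceptance threshold\<close>

definition pi0 :: "(real \<Rightarrow> real) \<Rightarrow> nat \<Rightarrow> real \<Rightarrow> real" where
  "pi0 F N r = (LBINT x=0..r. (1 - F x) ^ (N - 1))"

definition threshold_equation :: "(real \<Rightarrow> real) \<Rightarrow> nat \<Rightarrow> real \<Rightarrow> real \<Rightarrow> real \<Rightarrow> bool" where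
  "threshold_equation F N r p v \<longleftrightarrow> p - v = (LBINT x=v..r. (1 - F x) ^ (N - 1))"

definition vstar :: "(real \<Rightarrow> real) \<Rightarrow> nat \<Rightarrow> real \<Rightarrow> real \<Rightarrow> real" where
  "vstar F N r p =
     (if p \<le> pi0 F N r then 0 else (THE v. v \<in> {0..1} \<and> threshold_equation F N r p v))"

end

(*
  With truthful bids and a zero bid of the speculator, a rejecting seller earns something only if
  everybody else rejects too. By the layer-cake formula his expected gain is then the integral from
  v to r of the product over the other sellers j of G_j x = P(seller j rejects and v_j > x). Every
  G_j is below 1 on the positive axis, so v plus this gain increases strictly with v, and the best
  response is to accept below a cutoff t_i. If t_i < t_j, then both G_i and G_j agree with 1 - F
  beyond t_j, so that the indifference of j at t_j carries over to i; by strict monotonicity i then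
  strictly prefers to accept slightly above t_i, a contradiction. With a common cutoff t the gain
  at t is the integral of (1 - F)^(N - 1), which is the equation for the threshold.
*)

theory Submission imports Defs begin

subsection \<open>Dominant strategies in the auction\<close>

text \<open>The obstacle is a circularity: each cutoff is determined by the tails of the other
  sellers, and these tails depend on their cutoffs. It dissolves because the condition at a cutoff t
  integrates the tail only over [t, r], and beyond a seller's own cutoff his tail no longer
  remembers his acceptance rule. The condition for a common cutoff therefore mentions only
  \<open>D\<close>, \<open>N\<close>, r and p.

  Strict monotonicity is drawn from F > 0 on the positive axis and not from F being strictly
  increasing: F may be constant on whole intervals. A low price can make every type prefer the
  auction, which puts the cutoff in the corner 0 with an inequality in place of the indifference
  equation; hence the two cases of \<open>is_cutoff\<close>.

  Auction strategies are compared state by state before integrating. The comparison then survives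
  under every belief, so that beliefs at unreached information sets can be chosen freely in the
  existence proof. The type at an interior cutoff is indifferent, but since \<open>D\<close> has no
  atoms his decision affects neither the laws of the states nor the beliefs derived from
  them.\<close>

lemma seller_gain_truthful:
  "seller_gain r v v C = max 0 (Min (insert r (set_mset C)) - v)"
proof -
  define m where "m = Min (insert r (set_mset C))"
  have "v \<le> m \<longleftrightarrow> v \<le> r \<and> (\<forall>c\<in>#C. v \<le> c)"
    by (simp add: m_def)
  then have gain: "seller_gain r v v C = (if v \<le> m then (m - v) / (1 + real (count C v)) else 0)"
    by (simp add: seller_gain_def m_def)
  \<comment> \<open>A tie at the lowest bid v forces the price down to v, so the tie-breaking share
    divides zero.\<close>
  have "m = v" if "v \<in># C" "v \<le> m"
    using that by (intro order.antisym) (auto simp: m_def)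
  then have "seller_gain r v v C = max 0 (m - v)"
    unfolding gain by (cases "v \<in># C") (auto simp: not_in_iff)
  then show ?thesis by (simp add: m_def)
qed

text \<open>The price m is set by the competing bids and r. A bid only decides whether, and with
  which tie share, m - v is collected; the truthful bid collects exactly its positive part.\<close>

lemma seller_gain_le_truthful: "seller_gain r v b C \<le> seller_gain r v v C"
proof -
  define m where "m = Min (insert r (set_mset C))"
  have "(m - v) / (1 + real (count C b)) \<le> max 0 (m - v)"
  proof (cases "v \<le> m")
    case True
    then have "(m - v) * 1 \<le> (m - v) * (1 + real (count C b))" by (intro mult_left_mono) auto
    then show ?thesis by (simp add: pos_divide_le_eq max_def)
  next
    case False
    then show ?thesis by (simp add: divide_le_0_iff)
  qed
  then have "seller_gain r v b C \<le> max 0 (m - v)"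
    by (simp add: seller_gain_def m_def)
  then show ?thesis
    by (simp add: seller_gain_truthful m_def)
qed

lemma speculator_gain_zero_bid:
  assumes "0 \<le> r"
  shows "speculator_gain r {#0#} C = (if \<forall>c\<in>#C. 0 \<le> c then Min (insert r (set_mset C)) else 0)"
proof (cases "0 \<in># C \<and> (\<forall>c\<in>#C. 0 \<le> c)")
  case True
  \<comment> \<open>In a tie at zero the price is zero too, so the share lost to the tie costs
    nothing.\<close>
  then have "Min (insert r (set_mset C)) = 0"
    using assms by (intro Min_eqI) auto
  then show ?thesis using assms by (simp add: speculator_gain_def)
next
  case False
  then show ?thesis using assms by (auto simp: speculator_gain_def not_in_iff)
qed

text \<open>Against nonnegative bids a single zero bid earns m, the price set by the sellers and r.
  Further bids of his own compete with his lowest one and can only lower the price q below m, and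
  the winning share s is at most 1.\<close>

lemma speculator_gain_le_zero_bid:
  assumes "0 \<le> r" "\<And>b. b \<in># B \<Longrightarrow> 0 \<le> b"
  shows "speculator_gain r B C \<le> speculator_gain r {#0#} C"
proof (cases "B \<noteq> {#} \<and> (\<forall>c\<in>#C. 0 \<le> c)")
  case False
  then consider "B = {#}" | c where "B \<noteq> {#}" "c \<in># C" "c < 0" by force
  then show ?thesis
  proof cases
    case 1
    then show ?thesis using assms(1) by (simp add: speculator_gain_zero_bid speculator_gain_def)
  next
    case 2
    \<comment> \<open>A negative seller bid beats \<open>B\<close> and the zero bid alike, so both
      gains vanish.\<close>
    have "Min (set_mset B) \<in># B" using 2 by simp
    then have "0 \<le> Min (set_mset B)" by (rule assms(2))
    with 2 have "c < Min (set_mset B)" by linarith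
    with 2 have "\<not> (\<forall>c\<in>#C. Min (set_mset B) \<le> c)" by (metis not_le)
    then have "speculator_gain r B C = 0"
      unfolding speculator_gain_def Let_def by (simp only: simp_thms if_False if_cancel)
    moreover have "speculator_gain r {#0#} C = 0"
      using speculator_gain_zero_bid[OF assms(1), of C] 2 by force
    ultimately show ?thesis by simp
  qed
next
  case True
  define m where "m = Min (insert r (set_mset C))"
  define b where "b = Min (set_mset B)"
  have b: "b \<in># B" using True by (simp add: b_def)
  have eq: "B + C - {#b#} = (B - {#b#}) + C" using b by simp
  define q where "q = Min (insert r (set_mset (B + C - {#b#})))"
  have q0: "0 \<le> q"
    unfolding q_def eq using True assms by (auto dest: in_diffD)
  have qm: "q \<le> m" unfolding q_def m_def eq by (intro Min_antimono) auto
  define s where "s = real (count B b) / real (count B b + count C b)"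
  have "s \<le> 1" unfolding s_def by (auto simp: divide_le_eq_1)
  then have "q * s \<le> m"
    using mult_left_le[OF _ q0] qm by fastforce
  then have "speculator_gain r B C \<le> m" using True q0 qm
    unfolding speculator_gain_def Let_def b_def[symmetric] q_def[symmetric] s_def[symmetric] by simp
  then show ?thesis using True assms(1) by (simp add: speculator_gain_zero_bid m_def)
qed

subsection \<open>Cutoffs\<close>

text \<open>If g is the upper tail of M, the lowest competing value when all others reject and 0
  otherwise, then for 0 \<le> v \<le> r this is the expectation of max v (min r M). It is the price
  that makes type v indifferent between selling to the speculator and waiting for the
  auction.\<close>

definition trade_value :: "(real \<Rightarrow> real) \<Rightarrow> real \<Rightarrow> real \<Rightarrow> real" where
  "trade_value g r v = v + (LBINT x=ereal v..ereal r. g x)"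

lemma trade_value_cong:
  assumes "v \<le> r" "\<And>x. v \<le> x \<Longrightarrow> g x = h x"
  shows "trade_value g r v = trade_value h r v"
  unfolding trade_value_def using assms
  by (simp add: interval_integral_Icc) (intro set_lebesgue_integral_cong, auto)

text \<open>
  For \<open>0 \<le> v \<le> r\<close>, a seller whose competitors have upper tail \<open>g\<close> prefers to accept iff
  \<open>trade_value g r v < p\<close>.
\<close>

definition is_cutoff :: "(real \<Rightarrow> real) \<Rightarrow> real \<Rightarrow> real \<Rightarrow> real \<Rightarrow> bool" where
  "is_cutoff g r p t \<longleftrightarrow> 0 \<le> t \<and> t \<le> p \<and> (if t = 0 then p \<le> trade_value g r 0 else trade_value g r t = p)"

text \<open>Covers the equilibrium-dependent tail \<open>others_tail\<close> and the primitive tail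
  \<open>value_tail\<close> at once. The strict bound is restricted to x > 0 because at the origin a
  tail can equal 1.\<close>

locale tail_function =
  fixes g :: "real \<Rightarrow> real"
  assumes antimono: "antimono g"
    and nonneg: "0 \<le> g x"
    and le_1: "g x \<le> 1"
    and less_1: "0 < x \<Longrightarrow> g x < 1"
begin

lemma borel_measurable [measurable]: "g \<in> borel_measurable borel"
proof -
  have "mono (\<lambda>x. - g x)" using antimono by (auto simp: monotone_def)
  then have "(\<lambda>x. - g x) \<in> borel_measurable borel" by (rule borel_measurable_mono)
  then have "(\<lambda>x. - (- g x)) \<in> borel_measurable borel" by (rule borel_measurable_uminus)
  then show ?thesis by simp
qed

lemma set_integrable: "set_integrable lborel {a..b} g"
  unfolding set_integrable_def
  by (rule integrableI_bounded_set_indicator[where B=1]) (auto simp: nonneg le_1 emeasure_lborel_Icc_eq)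

lemma interval_integrable: "interval_lebesgue_integrable lborel (ereal a) (ereal b) g"
  unfolding interval_lebesgue_integrable_def
  by (auto intro: set_integrable_subset[OF set_integrable[of a b]] set_integrable_subset[OF set_integrable[of b a]])

lemma integral_split:
  "(LBINT x=ereal a..ereal b. g x) + (LBINT x=ereal b..ereal c. g x) = (LBINT x=ereal a..ereal c. g x)"
  by (rule interval_integral_sum)
    (use interval_integrable in \<open>auto simp: min_def max_def\<close>)

lemma integral_le:
  assumes "a \<le> b" "\<And>x. a \<le> x \<Longrightarrow> x \<le> b \<Longrightarrow> g x \<le> c"
  shows "(LBINT x=ereal a..ereal b. g x) \<le> c * (b - a)"
proof -
  have "(LBINT x:{a..b}. g x) \<le> (LBINT x:{a..b}. c)"
    by (rule set_integral_mono) (use assms set_integrable in \<open>auto simp: set_integrable_def\<close>)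
  also have "\<dots> = c * (b - a)" using assms by (simp add: set_lebesgue_integral_def)
  finally show ?thesis using assms by (simp add: interval_integral_Icc)
qed

lemma integral_nonneg: "a \<le> b \<Longrightarrow> 0 \<le> (LBINT x=ereal a..ereal b. g x)"
  by (simp add: interval_integral_Icc set_lebesgue_integral_def integral_nonneg_AE nonneg)

lemma trade_value_diff: "trade_value g r w - trade_value g r v = (w - v) - (LBINT x=ereal v..ereal w. g x)"
  using integral_split[of v w r] by (simp add: trade_value_def)

lemma trade_value_less:
  assumes "0 \<le> v" "v < w"
  shows "trade_value g r v < trade_value g r w"
proof -
  \<comment> \<open>The midpoint is positive even if v = 0, where g may be 1. Beyond it,
    antimonotonicity bounds g by the single number g m < 1, which yields the strict gap.\<close>
  define m where "m = (v + w) / 2"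
  have m: "v < m" "m < w" "0 < m" using assms by (auto simp: m_def)
  have "(LBINT x=ereal v..ereal m. g x) \<le> 1 * (m - v)"
    by (rule integral_le) (use m le_1 in auto)
  moreover have "(LBINT x=ereal m..ereal w. g x) \<le> g m * (w - m)"
    by (rule integral_le) (use m antimono in \<open>auto simp: monotone_def\<close>)
  moreover have "g m * (w - m) < 1 * (w - m)"
    by (rule mult_strict_right_mono) (use m less_1 in auto)
  ultimately have "(LBINT x=ereal v..ereal w. g x) < w - v"
    using integral_split[of v m w] by simp
  then show ?thesis using trade_value_diff[of r w v] by simp
qed

lemma trade_value_less_iff: "0 \<le> v \<Longrightarrow> 0 \<le> w \<Longrightarrow> trade_value g r v < trade_value g r w \<longleftrightarrow> v < w"
  using trade_value_less[of v w r] trade_value_less[of w v r] by (cases v w rule: linorder_cases) auto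

text \<open>The slope is 1 - g, which lies between 0 and 1. Integrating these bounds gives a
  Lipschitz estimate that tolerates jumps of g.\<close>

lemma continuous_on_trade_value: "continuous_on S (trade_value g r)"
proof -
  have *: "\<bar>trade_value g r w - trade_value g r v\<bar> \<le> w - v" if "v \<le> w" for v w
    using trade_value_diff[of r w v] integral_le[OF that, of 1] integral_nonneg[OF that] le_1 that by auto
  have "1-lipschitz_on S (trade_value g r)"
  proof (rule lipschitz_onI)
    fix v w show "dist (trade_value g r v) (trade_value g r w) \<le> 1 * dist v w"
      using *[of v w] *[of w v] by (cases v w rule: linorder_le_cases) (auto simp: dist_real_def abs_minus_commute)
  qed simp
  then show ?thesis by (rule lipschitz_on_continuous_on)
qed

lemma trade_value_self: "trade_value g r r = r"
  by (simp add: trade_value_def)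

lemma le_trade_value: "v \<le> r \<Longrightarrow> v \<le> trade_value g r v"
  using integral_nonneg[of v r] by (simp add: trade_value_def)

lemma is_cutoff_exists:
  assumes "0 \<le> p" "p \<le> r"
  obtains t where "is_cutoff g r p t"
proof (cases "p \<le> trade_value g r 0")
  case True
  then show thesis using that[of 0] assms by (simp add: is_cutoff_def)
next
  case False
  \<comment> \<open>Type p gets nothing by accepting the price p, so the crossing lies between 0 and
    p.\<close>
  moreover have "p \<le> trade_value g r p" using assms by (intro le_trade_value)
  ultimately obtain t where t: "0 \<le> t" "t \<le> p" "trade_value g r t = p"
    using IVT'[of "trade_value g r" 0 p p] assms continuous_on_trade_value by force
  moreover have "t \<noteq> 0" using t False by auto
  ultimately show thesis using that[of t] by (simp add: is_cutoff_def)
qed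

lemma is_cutoff_ge: "is_cutoff g r p t \<Longrightarrow> p \<le> trade_value g r t"
  by (auto simp: is_cutoff_def split: if_splits)

text \<open>Strict monotonicity around t in the interior case. In the corner t = 0 both sides are
  false: p is at most the trade value at 0, hence at most that of any v \<ge> 0.\<close>

lemma is_cutoff_less_iff:
  assumes "is_cutoff g r p t" "0 \<le> v"
  shows "trade_value g r v < p \<longleftrightarrow> v < t"
  using assms trade_value_less_iff[of v t r] trade_value_less_iff[of 0 v r]
  by (cases "t = 0"; cases "v = 0") (auto simp: is_cutoff_def)

lemma is_cutoff_unique:
  assumes "is_cutoff g r p s" "is_cutoff g r p t"
  shows "s = t"
proof -
  have "0 \<le> s" "0 \<le> t" using assms by (simp_all add: is_cutoff_def)
  then have "\<not> s < t" "\<not> t < s"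
    using is_cutoff_less_iff[OF assms(1), of t] is_cutoff_less_iff[OF assms(2), of s]
      is_cutoff_ge[OF assms(1)] is_cutoff_ge[OF assms(2)] by (simp_all add: not_less)
  then show ?thesis by simp
qed

end

subsection \<open>The law of the states after stage 1\<close>

abbreviation state_space :: "(real \<times> bool) measure" where
  "state_space \<equiv> borel \<Otimes>\<^sub>M count_space UNIV"

definition acceptance_rule :: "(real \<Rightarrow> real) \<Rightarrow> bool" where
  "acceptance_rule \<alpha> \<longleftrightarrow> \<alpha> \<in> borel_measurable borel \<and> (\<forall>v\<in>{0..1}. \<alpha> v \<in> {0..1})"

definition reject_tail :: "real measure \<Rightarrow> (real \<Rightarrow> real) \<Rightarrow> real \<Rightarrow> real" where
  "reject_tail D \<alpha> x = measure (state_law D \<alpha>) ({x<..} \<times> {False})"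

locale value_distribution = prob_space D for D :: "real measure" +
  assumes sets_D [measurable_cong]: "sets D = sets borel"
    and AE_D: "AE v in D. v \<in> {0..1}"
    and measure_point: "measure D {x} = 0"
    and cdf_pos: "0 < x \<Longrightarrow> 0 < cdf D x"
begin

sublocale real_distribution D
  by unfold_locales (rule emeasure_space_1 sets_D sets_eq_imp_space_eq[OF sets_D, simplified])+

lemma AE_neq: "AE v in D. v \<noteq> t"
  using AE_iff_measurable[of "{t}" D "\<lambda>v. v \<noteq> t"] sets_eq_imp_space_eq[OF sets_D]
  by (simp add: sets_D emeasure_eq_measure measure_point)

lemma sets_state_law [measurable_cong]: "sets (state_law D \<alpha>) = sets state_space"
  unfolding state_law_def sets_density by (intro sets_pair_measure_cong sets_D refl)

lemma space_state_law: "space (state_law D \<alpha>) = UNIV"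
  using sets_eq_imp_space_eq[OF sets_state_law[of \<alpha>]] by (simp add: space_pair_measure)

lemma density_measurable:
  assumes "\<alpha> \<in> borel_measurable borel"
  shows "(\<lambda>(v, d). ennreal (if d then \<alpha> v else 1 - \<alpha> v)) \<in> borel_measurable (D \<Otimes>\<^sub>M count_space UNIV)"
  using assms by measurable

lemma nn_integral_state_law:
  assumes "\<alpha> \<in> borel_measurable borel" and [measurable]: "h \<in> borel_measurable state_space"
  shows "(\<integral>\<^sup>+s. h s \<partial>state_law D \<alpha>) =
    (\<integral>\<^sup>+v. ennreal (\<alpha> v) * h (v, True) + ennreal (1 - \<alpha> v) * h (v, False) \<partial>D)"
proof -
  note [measurable] = assms(1)
  interpret S: sigma_finite_measure "count_space (UNIV :: bool set)"
    by (rule sigma_finite_measure_count_space_finite) simp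
  have "(\<integral>\<^sup>+s. h s \<partial>state_law D \<alpha>) =
      (\<integral>\<^sup>+s. (case s of (v, d) \<Rightarrow> ennreal (if d then \<alpha> v else 1 - \<alpha> v)) * h s \<partial>(D \<Otimes>\<^sub>M count_space UNIV))"
    unfolding state_law_def
    by (rule nn_integral_density) (use density_measurable assms in auto)
  also have "\<dots> = (\<integral>\<^sup>+v. \<integral>\<^sup>+d. ennreal (if d then \<alpha> v else 1 - \<alpha> v) * h (v, d) \<partial>count_space UNIV \<partial>D)"
    by (subst S.nn_integral_fst[symmetric]) auto
  also have "\<dots> = (\<integral>\<^sup>+v. ennreal (\<alpha> v) * h (v, True) + ennreal (1 - \<alpha> v) * h (v, False) \<partial>D)"
    by (intro nn_integral_cong) (simp add: nn_integral_count_space_finite UNIV_bool add.commute)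
  finally show ?thesis .
qed

lemma prob_space_state_law:
  assumes "acceptance_rule \<alpha>"
  shows "prob_space (state_law D \<alpha>)"
proof
  have "emeasure (state_law D \<alpha>) (space (state_law D \<alpha>)) = (\<integral>\<^sup>+s. 1 \<partial>state_law D \<alpha>)"
    by simp
  also have "\<dots> = (\<integral>\<^sup>+v. ennreal (\<alpha> v) * 1 + ennreal (1 - \<alpha> v) * 1 \<partial>D)"
    using assms by (intro nn_integral_state_law) (auto simp: acceptance_rule_def)
  also have "\<dots> = (\<integral>\<^sup>+v. 1 \<partial>D)"
    using AE_D assms
    by (intro nn_integral_cong_AE) (auto simp: acceptance_rule_def ennreal_plus[symmetric] simp del: ennreal_plus)
  also have "\<dots> = 1" using emeasure_space_1 by simp
  finally show "emeasure (state_law D \<alpha>) (space (state_law D \<alpha>)) = 1" .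
qed

lemma AE_state_law:
  assumes "acceptance_rule \<alpha>"
  shows "AE s in state_law D \<alpha>. fst s \<in> {0..1}"
proof -
  have "{s \<in> space state_space. fst s \<notin> {0..1}} \<in> sets state_space" by measurable
  then have [measurable]: "{s. fst s \<notin> {0..1}} \<in> sets state_space" by (simp add: space_pair_measure)
  have "(\<integral>\<^sup>+s. indicator {s. fst s \<notin> {0..1}} s \<partial>state_law D \<alpha>) =
     (\<integral>\<^sup>+v. ennreal (\<alpha> v) * indicator {s. fst s \<notin> {0..1}} (v, True)
        + ennreal (1 - \<alpha> v) * indicator {s. fst s \<notin> {0..1}} (v, False) \<partial>D)"
    using assms by (intro nn_integral_state_law) (auto simp: acceptance_rule_def simp del: atLeastAtMost_iff)
  also have "\<dots> = (\<integral>\<^sup>+v. 0 \<partial>D)"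
    using AE_D by (intro nn_integral_cong_AE) auto
  finally have "emeasure (state_law D \<alpha>) {s. fst s \<notin> {0..1}} = 0"
    by (subst (asm) nn_integral_indicator) (auto simp: sets_state_law simp del: atLeastAtMost_iff)
  then show ?thesis
    by (subst AE_iff_measurable[of "{s. fst s \<notin> {0..1}}"]) (auto simp: space_state_law sets_state_law simp del: atLeastAtMost_iff)
qed

text \<open>The reason why agreement of acceptance rules almost everywhere suffices for uniqueness:
  the laws of the states coincide exactly, and with them all beliefs that Bayes' rule
  determines.\<close>

lemma state_law_cong:
  assumes "acceptance_rule \<alpha>" "acceptance_rule \<beta>" "AE v in D. \<alpha> v = \<beta> v"
  shows "state_law D \<alpha> = state_law D \<beta>"
proof (rule measure_eqI)
  show "sets (state_law D \<alpha>) = sets (state_law D \<beta>)" by (simp add: sets_state_law)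
  fix X assume "X \<in> sets (state_law D \<alpha>)"
  then have X [measurable]: "X \<in> sets state_space" by (simp add: sets_state_law)
  have "emeasure (state_law D \<gamma>) X = (\<integral>\<^sup>+v. ennreal (\<gamma> v) * indicator X (v, True)
        + ennreal (1 - \<gamma> v) * indicator X (v, False) \<partial>D)" if "acceptance_rule \<gamma>" for \<gamma>
    using that X by (subst nn_integral_state_law[symmetric]) (auto simp: acceptance_rule_def sets_state_law)
  then show "emeasure (state_law D \<alpha>) X = emeasure (state_law D \<beta>) X"
    using assms by (auto intro!: nn_integral_cong_AE)
qed

lemma reject_tail_nonneg: "0 \<le> reject_tail D \<alpha> x"
  by (simp add: reject_tail_def)

lemma reject_tail_antimono:
  assumes "acceptance_rule \<alpha>"
  shows "antimono (reject_tail D \<alpha>)"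
proof
  interpret S: prob_space "state_law D \<alpha>" by (rule prob_space_state_law[OF assms])
  fix x y :: real assume "x \<le> y"
  then show "reject_tail D \<alpha> y \<le> reject_tail D \<alpha> x"
    unfolding reject_tail_def by (intro S.finite_measure_mono) auto
qed

lemma emeasure_reject:
  assumes "acceptance_rule \<alpha>"
  shows "emeasure (state_law D \<alpha>) ({x<..} \<times> {False}) = (\<integral>\<^sup>+v. indicator {x<..} v * ennreal (1 - \<alpha> v) \<partial>D)"
proof -
  have "emeasure (state_law D \<alpha>) ({x<..} \<times> {False}) = (\<integral>\<^sup>+s. indicator ({x<..} \<times> {False}) s \<partial>state_law D \<alpha>)"
    by (subst nn_integral_indicator) auto
  also have "\<dots> = (\<integral>\<^sup>+v. ennreal (\<alpha> v) * indicator ({x<..} \<times> {False}) (v, True)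
        + ennreal (1 - \<alpha> v) * indicator ({x<..} \<times> {False}) (v, False) \<partial>D)"
    using assms by (intro nn_integral_state_law) (auto simp: acceptance_rule_def)
  also have "\<dots> = (\<integral>\<^sup>+v. indicator {x<..} v * ennreal (1 - \<alpha> v) \<partial>D)"
    by (intro nn_integral_cong) (auto split: split_indicator)
  finally show ?thesis .
qed

lemma measure_greaterThan: "measure D {x<..} = 1 - cdf D x"
proof -
  have "measure D (space D - {..x}) = 1 - measure D {..x}"
    by (rule prob_compl) (simp add: sets_D)
  moreover have "space D - {..x} = {x<..}" using sets_eq_imp_space_eq[OF sets_D] by auto
  ultimately show ?thesis by (simp add: cdf_def)
qed

lemma reject_tail_le:
  assumes "acceptance_rule \<alpha>"
  shows "reject_tail D \<alpha> x \<le> 1 - cdf D x"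
proof -
  have "emeasure (state_law D \<alpha>) ({x<..} \<times> {False}) \<le> (\<integral>\<^sup>+v. indicator {x<..} v \<partial>D)"
    unfolding emeasure_reject[OF assms] using AE_D assms
    by (intro nn_integral_mono_AE) (auto simp: acceptance_rule_def split: split_indicator)
  also have "\<dots> = emeasure D {x<..}" by (simp add: sets_D)
  finally have "reject_tail D \<alpha> x \<le> measure D {x<..}"
    unfolding reject_tail_def measure_def by (intro enn2real_mono) (auto simp: emeasure_eq_measure)
  then show ?thesis by (simp add: measure_greaterThan)
qed

text \<open>The decision of type t is left open because an atomless law does not see it. Sellers
  with values between x and t all accept, which makes the tail constant below t.\<close>

lemma reject_tail_cutoff:
  assumes "acceptance_rule \<alpha>"
    and "\<And>v. 0 \<le> v \<Longrightarrow> v < t \<Longrightarrow> \<alpha> v = 1" "\<And>v. t < v \<Longrightarrow> v \<le> 1 \<Longrightarrow> \<alpha> v = 0"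
  shows "reject_tail D \<alpha> x = 1 - cdf D (max x t)"
proof -
  have "emeasure (state_law D \<alpha>) ({x<..} \<times> {False}) = (\<integral>\<^sup>+v. indicator {max x t<..} v \<partial>D)"
    unfolding emeasure_reject[OF assms(1)]
  proof (rule nn_integral_cong_AE, use AE_D AE_neq[of t] in eventually_elim)
    fix v :: real assume "v \<in> {0..1}" "v \<noteq> t"
    then show "indicator {x<..} v * ennreal (1 - \<alpha> v) = indicator {max x t<..} v"
      using assms(2,3)[of v] by (cases v t rule: linorder_cases) (auto split: split_indicator)
  qed
  also have "\<dots> = emeasure D {max x t<..}" by (simp add: sets_D)
  finally show ?thesis by (simp add: reject_tail_def measure_def flip: measure_greaterThan)
qed

end

subsection \<open>The expected gain from rejecting\<close>

text \<open>The bid functions b are kept because truthful bids are prescribed only for values in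
  {0..1}, while states range over all reals. Replacing bids by values is valid only almost surely
  and is postponed to the integral.\<close>

definition rejection_gain ::
  "nat set \<Rightarrow> real \<Rightarrow> (nat \<Rightarrow> real \<Rightarrow> real) \<Rightarrow> real \<Rightarrow> (nat \<Rightarrow> real \<times> bool) \<Rightarrow> real" where
  "rejection_gain J r b v \<omega> =
     (if \<forall>j\<in>J. \<not> snd (\<omega> j) then max 0 (Min (insert r ((\<lambda>j. b j (fst (\<omega> j))) ` J)) - v) else 0)"

lemma rejection_gain_nonneg: "0 \<le> rejection_gain J r b v \<omega>"
  by (simp add: rejection_gain_def)

lemma measurable_component_state:
  assumes "sets M = sets (PiM J (\<lambda>_. state_space))" "j \<in> J"
  shows "(\<lambda>\<omega>. fst (\<omega> j)) \<in> borel_measurable M" "(\<lambda>\<omega>. snd (\<omega> j)) \<in> measurable M (count_space UNIV)"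
proof -
  have "(\<lambda>\<omega>. \<omega> j) \<in> measurable M state_space"
    using measurable_component_singleton[OF assms(2), of "\<lambda>_. state_space"]
      measurable_cong_sets[OF assms(1) refl] by auto
  then show "(\<lambda>\<omega>. fst (\<omega> j)) \<in> borel_measurable M" "(\<lambda>\<omega>. snd (\<omega> j)) \<in> measurable M (count_space UNIV)"
    by (auto intro: measurable_compose)
qed

lemma measurable_all_reject:
  assumes "sets M = sets (PiM J (\<lambda>_. state_space))" "finite J"
  shows "{\<omega> \<in> space M. \<forall>j\<in>J. \<not> snd (\<omega> j)} \<in> sets M"
proof -
  note [measurable] = measurable_component_state[OF assms(1)] and [simp] = assms(2)
  show ?thesis by measurable
qed

lemma borel_measurable_Min_insert:
  assumes "finite J" "\<And>j. j \<in> J \<Longrightarrow> h j \<in> borel_measurable M"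
  shows "(\<lambda>\<omega>. Min (insert (r :: real) ((\<lambda>j. h j \<omega>) ` J))) \<in> borel_measurable M"
proof -
  \<comment> \<open>The index \<open>None\<close> carries the constant r, which turns the reserve
    price into one more member of a finite family.\<close>
  have "(\<lambda>\<omega>. Min ((\<lambda>k. case k of None \<Rightarrow> r | Some j \<Rightarrow> h j \<omega>) ` (insert None (Some ` J)))) \<in> borel_measurable M"
    using assms by (intro borel_measurable_Min) auto
  then show ?thesis by (simp add: image_image)
qed

lemma borel_measurable_rejection_gain:
  assumes "sets M = sets (PiM J (\<lambda>_. state_space))" "finite J"
    "\<And>j. j \<in> J \<Longrightarrow> b j \<in> borel_measurable borel"
  shows "rejection_gain J r b v \<in> borel_measurable M"
proof -
  note [measurable] = measurable_component_state[OF assms(1)] assms(3)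
  have 1: "(\<lambda>\<omega>. Min (insert r ((\<lambda>j. b j (fst (\<omega> j))) ` J))) \<in> borel_measurable M"
    by (rule borel_measurable_Min_insert[OF assms(2)]) measurable
  then show ?thesis
    unfolding rejection_gain_def
    using measurable_all_reject[OF assms(1,2)]
    by (intro measurable_If borel_measurable_max borel_measurable_diff) auto
qed

lemma rejection_gain_bounded:
  assumes "0 \<le> v" "0 \<le> r" "finite J"
  shows "rejection_gain J r b v \<omega> \<le> r"
proof -
  have "Min (insert r ((\<lambda>j. b j (fst (\<omega> j))) ` J)) \<le> r" using assms by simp
  then have "Min (insert r ((\<lambda>j. b j (fst (\<omega> j))) ` J)) - v \<le> r" using assms by linarith
  then show ?thesis using assms by (simp add: rejection_gain_def)
qed

lemma integrable_rejection_gain: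
  assumes "prob_space M" "sets M = sets (PiM J (\<lambda>_. state_space))" "finite J"
    "\<And>j. j \<in> J \<Longrightarrow> b j \<in> borel_measurable borel" "0 \<le> v" "0 \<le> r"
  shows "integrable M (rejection_gain J r b v)"
proof -
  interpret prob_space M by fact
  show ?thesis
    by (rule integrable_const_bound[where B=r])
      (use assms rejection_gain_bounded rejection_gain_nonneg borel_measurable_rejection_gain in auto)
qed

text \<open>Layer cake for a single state. That x lies below all bids and everybody rejects is a
  conjunction over the sellers, so its indicator splits into one factor per seller; independence can
  act on this product later.\<close>

lemma ennreal_rejection_gain:
  assumes "finite J" "\<And>j. j \<in> J \<Longrightarrow> b j (fst (\<omega> j)) = fst (\<omega> j)"
  shows "ennreal (rejection_gain J r b v \<omega>) =
    (\<integral>\<^sup>+x. indicator {v..<r} x * (\<Prod>j\<in>J. indicator ({x<..} \<times> {False}) (\<omega> j)) \<partial>lborel)"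
proof -
  have prod: "(\<Prod>j\<in>J. indicator ({x<..} \<times> {False}) (\<omega> j)) =
      (indicator {x. \<forall>j\<in>J. x < fst (\<omega> j) \<and> \<not> snd (\<omega> j)} x :: ennreal)" for x
  proof (cases "\<forall>j\<in>J. x < fst (\<omega> j) \<and> \<not> snd (\<omega> j)")
    case True
    then have "\<forall>j\<in>J. indicator ({x<..} \<times> {False}) (\<omega> j) = (1 :: ennreal)"
      by (auto simp: indicator_def mem_Times_iff)
    with True show ?thesis by simp
  next
    case False
    then have "\<exists>j\<in>J. indicator ({x<..} \<times> {False}) (\<omega> j) = (0 :: ennreal)"
      by (auto simp: indicator_def mem_Times_iff)
    with False assms(1) show ?thesis by (auto simp: prod_zero_iff)
  qed
  define m where "m = Min (insert r ((\<lambda>j. b j (fst (\<omega> j))) ` J))"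
  have less: "x < m \<longleftrightarrow> x < r \<and> (\<forall>j\<in>J. x < fst (\<omega> j))" for x
    using assms by (simp add: m_def)
  show ?thesis
  proof (cases "\<forall>j\<in>J. \<not> snd (\<omega> j)")
    case True
    have "indicator {v..<r} x * (\<Prod>j\<in>J. indicator ({x<..} \<times> {False}) (\<omega> j)) = (indicator {v..<m} x :: ennreal)" for x
      unfolding prod using True less[of x] by (auto split: split_indicator)
    then have "(\<integral>\<^sup>+x. indicator {v..<r} x * (\<Prod>j\<in>J. indicator ({x<..} \<times> {False}) (\<omega> j)) \<partial>lborel)
        = emeasure lborel {v..<m}" by simp
    also have "\<dots> = ennreal (max 0 (m - v))"
      by (cases "v \<le> m") (auto simp: max_def)
    finally show ?thesis using True by (simp add: rejection_gain_def m_def)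
  next
    case False
    then have "indicator {v..<r} x * (\<Prod>j\<in>J. indicator ({x<..} \<times> {False}) (\<omega> j)) = (0 :: ennreal)" for x
      unfolding prod by (auto simp: indicator_def)
    then have "(\<integral>\<^sup>+x. indicator {v..<r} x * (\<Prod>j\<in>J. indicator ({x<..} \<times> {False}) (\<omega> j)) \<partial>lborel) = 0"
      by (simp only: nn_integral_const mult_zero_left)
    then show ?thesis unfolding rejection_gain_def using False by (simp only: if_False ennreal_0)
  qed
qed

section \<open>Expected rejection gain under independent states\<close>

context value_distribution
begin

lemma sets_PiM_state_law: "sets (PiM J (\<lambda>j. state_law D (\<alpha> j))) = sets (PiM J (\<lambda>_. state_space))"
  by (intro sets_PiM_cong refl sets_state_law)

lemma prob_space_PiM_state_law:
  "(\<And>j. j \<in> J \<Longrightarrow> acceptance_rule (\<alpha> j)) \<Longrightarrow> prob_space (PiM J (\<lambda>j. state_law D (\<alpha> j)))"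
  by (intro prob_space_PiM prob_space_state_law)

lemma tail_function_prod_reject_tail:
  assumes "finite J" "J \<noteq> {}" "\<And>j. j \<in> J \<Longrightarrow> acceptance_rule (\<alpha> j)"
  shows "tail_function (\<lambda>x. \<Prod>j\<in>J. reject_tail D (\<alpha> j) x)"
proof
  have le1: "reject_tail D (\<alpha> j) x \<le> 1" if "j \<in> J" for j x
    using reject_tail_le[OF assms(3)[OF that], of x] cdf_nonneg[of x] by linarith
  show "antimono (\<lambda>x. \<Prod>j\<in>J. reject_tail D (\<alpha> j) x)"
    using reject_tail_antimono[OF assms(3)]
    by (auto intro!: antimonoI prod_mono simp: reject_tail_nonneg dest: antimonoD)
  show "0 \<le> (\<Prod>j\<in>J. reject_tail D (\<alpha> j) x)" for x
    by (intro prod_nonneg) (simp add: reject_tail_nonneg)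
  show "(\<Prod>j\<in>J. reject_tail D (\<alpha> j) x) \<le> 1" for x
    using le1 by (intro prod_le_1) (auto simp: reject_tail_nonneg)
  fix x :: real assume x: "0 < x"
  \<comment> \<open>A single factor below 1 is enough, and one competitor exists because J is
    nonempty.\<close>
  obtain k where k: "k \<in> J" using assms(2) by auto
  have "(\<Prod>j\<in>J. reject_tail D (\<alpha> j) x) = reject_tail D (\<alpha> k) x * (\<Prod>j\<in>J-{k}. reject_tail D (\<alpha> j) x)"
    using assms(1) k by (rule prod.remove)
  also have "\<dots> \<le> reject_tail D (\<alpha> k) x * 1"
    using le1 by (intro mult_left_mono prod_le_1) (auto simp: reject_tail_nonneg)
  also have "\<dots> < 1" using reject_tail_le[OF assms(3)[OF k], of x] cdf_pos[OF x] by simp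
  finally show "(\<Prod>j\<in>J. reject_tail D (\<alpha> j) x) < 1" .
qed

lemma integral_rejection_gain:
  assumes J: "finite J" "J \<noteq> {}" and \<alpha>: "\<And>j. j \<in> J \<Longrightarrow> acceptance_rule (\<alpha> j)"
    and b: "\<And>j. j \<in> J \<Longrightarrow> b j \<in> borel_measurable borel" "\<And>j v. j \<in> J \<Longrightarrow> v \<in> {0..1} \<Longrightarrow> b j v = v"
  shows "(\<integral>\<omega>. rejection_gain J r b v \<omega> \<partial>PiM J (\<lambda>j. state_law D (\<alpha> j))) =
    (if v \<le> r then LBINT x=ereal v..ereal r. (\<Prod>j\<in>J. reject_tail D (\<alpha> j) x) else 0)"
proof -
  let ?g = "\<lambda>x. \<Prod>j\<in>J. reject_tail D (\<alpha> j) x"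
  interpret g: tail_function ?g by (rule tail_function_prod_reject_tail[OF J \<alpha>])
  \<comment> \<open>The product locale expects a probability measure at every index. A point mass
    fills in outside J, where the product over J does not look.\<close>
  define M where "M = (\<lambda>j. if j \<in> J then state_law D (\<alpha> j) else return state_space (0, False))"
  define P where "P = PiM J (\<lambda>j. state_law D (\<alpha> j))"
  have P_M: "P = PiM J M" unfolding P_def M_def by (rule PiM_cong) auto
  have M: "prob_space (M j)" for j
    using \<alpha> by (auto simp: M_def space_pair_measure intro!: prob_space_state_law prob_space_return)
  interpret M: product_prob_space M J
    by (rule product_prob_spaceI) (rule M)
  interpret P: prob_space P unfolding P_def by (rule prob_space_PiM_state_law[OF \<alpha>])
  interpret pair: pair_sigma_finite P lborel ..
  have sets_P: "sets P = sets (PiM J (\<lambda>_. state_space))" unfolding P_def by (rule sets_PiM_state_law)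
  note [measurable] = measurable_component_state[OF sets_P] and [simp] = J(1)
  have "AE \<omega> in P. \<forall>j\<in>J. fst (\<omega> j) \<in> {0..1}"
    unfolding P_def using \<alpha>
    by (intro AE_finite_allI J(1) AE_PiM_component prob_space_state_law AE_state_law) auto
  then have "(\<integral>\<^sup>+\<omega>. ennreal (rejection_gain J r b v \<omega>) \<partial>P) =
      (\<integral>\<^sup>+\<omega>. (\<integral>\<^sup>+x. indicator {v..<r} x * (\<Prod>j\<in>J. indicator ({x<..} \<times> {False}) (\<omega> j)) \<partial>lborel) \<partial>P)"
    by (intro nn_integral_cong_AE, eventually_elim) (use b J in \<open>auto intro!: ennreal_rejection_gain\<close>)
  also have "\<dots> = (\<integral>\<^sup>+x. (\<integral>\<^sup>+\<omega>. indicator {v..<r} x * (\<Prod>j\<in>J. indicator ({x<..} \<times> {False}) (\<omega> j)) \<partial>P) \<partial>lborel)"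
  proof (rule pair.Fubini'[symmetric])
    \<comment> \<open>Written with \<open>if\<close>, joint measurability in state and level follows
      from that of the components; the indicator form is recovered afterwards.\<close>
    have "(\<lambda>(\<omega>, x). indicator {v..<r} x * (\<Prod>j\<in>J. if x < fst (\<omega> j) \<and> \<not> snd (\<omega> j) then 1 else 0 :: ennreal))
        \<in> borel_measurable (P \<Otimes>\<^sub>M lborel)"
      by measurable
    then show "(\<lambda>(\<omega>, x). indicator {v..<r} x * (\<Prod>j\<in>J. indicator ({x<..} \<times> {False}) (\<omega> j) :: ennreal))
        \<in> borel_measurable (P \<Otimes>\<^sub>M lborel)"
      by (simp add: indicator_def mem_Times_iff)
  qed
  also have "\<dots> = (\<integral>\<^sup>+x. indicator {v..<r} x * ennreal (?g x) \<partial>lborel)"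
  proof (rule nn_integral_cong)
    fix x :: real
    have "(\<integral>\<^sup>+\<omega>. (\<Prod>j\<in>J. indicator ({x<..} \<times> {False}) (\<omega> j)) \<partial>P) =
        (\<Prod>j\<in>J. \<integral>\<^sup>+s. indicator ({x<..} \<times> {False}) s \<partial>M j)"
      unfolding P_M by (rule M.product_nn_integral_prod) (auto simp: M_def)
    also have "\<dots> = (\<Prod>j\<in>J. ennreal (reject_tail D (\<alpha> j) x))"
    proof (rule prod.cong)
      fix j assume j: "j \<in> J"
      interpret S: prob_space "state_law D (\<alpha> j)" by (rule prob_space_state_law[OF \<alpha>[OF j]])
      show "(\<integral>\<^sup>+s. indicator ({x<..} \<times> {False}) s \<partial>M j) = ennreal (reject_tail D (\<alpha> j) x)"
        using j by (simp add: M_def reject_tail_def S.emeasure_eq_measure sets_state_law)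
    qed simp
    finally have "(\<integral>\<^sup>+\<omega>. (\<Prod>j\<in>J. indicator ({x<..} \<times> {False}) (\<omega> j)) \<partial>P) = ennreal (?g x)"
      by (simp add: prod_ennreal reject_tail_nonneg)
    then show "(\<integral>\<^sup>+\<omega>. indicator {v..<r} x * (\<Prod>j\<in>J. indicator ({x<..} \<times> {False}) (\<omega> j)) \<partial>P)
        = indicator {v..<r} x * ennreal (?g x)"
      by (auto split: split_indicator)
  qed
  also have "\<dots> = (\<integral>\<^sup>+x. ennreal (indicator {v..<r} x * ?g x) \<partial>lborel)"
    by (intro nn_integral_cong) (auto split: split_indicator)
  finally have eq: "(\<integral>\<^sup>+\<omega>. ennreal (rejection_gain J r b v \<omega>) \<partial>P) = (\<integral>\<^sup>+x. ennreal (indicator {v..<r} x * ?g x) \<partial>lborel)" .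
  have "(\<integral>\<omega>. rejection_gain J r b v \<omega> \<partial>P) = enn2real (\<integral>\<^sup>+\<omega>. ennreal (rejection_gain J r b v \<omega>) \<partial>P)"
    by (intro integral_eq_nn_integral borel_measurable_rejection_gain[OF sets_P] b)
      (auto simp: rejection_gain_nonneg)
  also have "\<dots> = (LBINT x. indicator {v..<r} x * ?g x)"
    unfolding eq by (intro integral_eq_nn_integral[symmetric]) (auto simp: g.nonneg)
  \<comment> \<open>For v > r the set {v..<r} is empty and the gain 0, whereas the oriented interval
    integral would reverse its sign; hence the case distinction.\<close>
  also have "\<dots> = (if v \<le> r then LBINT x=ereal v..ereal r. ?g x else 0)"
    by (auto simp: interval_integral_Ico set_lebesgue_integral_def)
  finally show ?thesis by (simp add: P_def)
qed

end

subsection \<open>Best responses\<close>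

lemma acceptors_rejectors: "rejectors J \<omega> = J - acceptors J \<omega>" "acceptors J \<omega> \<subseteq> J"
  by (auto simp: rejectors_def acceptors_def)

lemma auction_size_in:
  assumes "i \<in> {1..N}"
  shows "auction_size N i \<omega> \<in> {1..N}"
proof -
  have "card (rejectors ({1..N} - {i}) \<omega>) \<le> card ({1..N} - {i})"
    by (rule card_mono) (auto simp: rejectors_def)
  then show ?thesis using assms by (auto simp: auction_size_def)
qed

text \<open>Only bids for auction size N enter: whenever somebody else accepts, the speculator's
  zero bid leaves the rejecting seller nothing.\<close>

definition continuation_gain :: "real measure \<Rightarrow> nat \<Rightarrow> real \<Rightarrow> assessment \<Rightarrow> nat \<Rightarrow> real \<Rightarrow> real" where
  "continuation_gain D N r \<sigma> i v =
     (\<integral>\<omega>. rejection_gain ({1..N} - {i}) r (\<lambda>j u. bid \<sigma> j u N) v \<omega> \<partial>states_law D \<sigma> ({1..N} - {i}))"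

text \<open>The identity holds in every state, so it can be integrated against the prior at stage 1
  and against any belief at stage 2.\<close>

lemma seller_gain_competing_bids:
  assumes "dominant_strategy_bidding N \<sigma>" "i \<in> {1..N}" "0 \<le> v"
  shows "seller_gain r v v (competing_bids N \<sigma> i \<omega>) =
    rejection_gain ({1..N} - {i}) r (\<lambda>j u. bid \<sigma> j u N) v \<omega>"
proof (cases "acceptors ({1..N} - {i}) \<omega> = {}")
  case True
  define J where "J = {1..N} - {i}"
  have rej: "rejectors J \<omega> = J" using True by (simp add: acceptors_rejectors J_def)
  have "card J = N - 1" using assms(2) by (simp add: J_def)
  then have "auction_size N i \<omega> = N" using assms(2) rej by (simp add: auction_size_def J_def)
  then have "competing_bids N \<sigma> i \<omega> = seller_bids \<sigma> J N \<omega>"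
    using True rej by (simp add: competing_bids_def J_def Let_def)
  moreover have "finite J" by (simp add: J_def)
  moreover have "\<forall>j\<in>J. \<not> snd (\<omega> j)" using True by (auto simp: acceptors_def J_def)
  ultimately show ?thesis
    unfolding J_def[symmetric] seller_gain_truthful rejection_gain_def
    by (simp add: seller_bids_def del: Min_insert)
next
  case False
  let ?A = "acceptors ({1..N} - {i}) \<omega>"
  have "?A \<subseteq> {1..N}" by (auto simp: acceptors_def)
  then have "spec_bids \<sigma> ?A = {#0#}"
    using assms(1) False unfolding dominant_strategy_bidding_def by blast
  then have "0 \<in># competing_bids N \<sigma> i \<omega>" using False by (simp add: competing_bids_def Let_def)
  then have "Min (insert r (set_mset (competing_bids N \<sigma> i \<omega>))) \<le> 0" by (intro Min_le) auto
  then have "seller_gain r v v (competing_bids N \<sigma> i \<omega>) = 0"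
    using assms(3) by (simp add: seller_gain_truthful del: Min_insert)
  moreover have "\<not> (\<forall>j\<in>{1..N} - {i}. \<not> snd (\<omega> j))" using False by (auto simp: acceptors_def)
  ultimately show ?thesis unfolding rejection_gain_def by (simp only: if_False)
qed

locale speculation_game = value_distribution D for D :: "real measure" +
  fixes N :: nat and r p :: real
  assumes N: "2 \<le> N" and r: "r \<in> {0<..1}" and p: "p \<in> {0..r}"
begin

definition others_tail :: "assessment \<Rightarrow> nat \<Rightarrow> real \<Rightarrow> real" where
  "others_tail \<sigma> i x = (\<Prod>j\<in>{1..N} - {i}. reject_tail D (accept \<sigma> j) x)"

definition value_tail :: "real \<Rightarrow> real" where
  "value_tail x = (1 - cdf D x) ^ (N - 1)"

lemma others_nonempty: "{1..N} - {i} \<noteq> {}"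
proof -
  have "(if i = 1 then 2 else 1) \<in> {1..N} - {i}" using N by auto
  then show ?thesis by blast
qed

lemma tail_function_value_tail: "tail_function value_tail"
proof
  show "antimono value_tail"
    unfolding value_tail_def using cdf_nondecreasing cdf_bounded_prob
    by (intro antimonoI power_mono) auto
  show "0 \<le> value_tail x" "value_tail x \<le> 1" for x
    using cdf_nonneg[of x] cdf_bounded_prob[of x] by (auto simp: value_tail_def intro!: power_le_one)
  show "value_tail x < 1" if "0 < x" for x
    unfolding value_tail_def using cdf_pos[OF that] cdf_bounded_prob[of x] N
    by (intro power_less_one_iff[THEN iffD2]) auto
qed

lemma wf_accept: "well_formed N \<sigma> \<Longrightarrow> i \<in> {1..N} \<Longrightarrow> acceptance_rule (accept \<sigma> i)"
  by (simp add: well_formed_def acceptance_rule_def)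

lemma wf_bid:
  "well_formed N \<sigma> \<Longrightarrow> i \<in> {1..N} \<Longrightarrow> n \<in> {1..N} \<Longrightarrow> (\<lambda>v. bid \<sigma> i v n) \<in> borel_measurable borel"
  by (simp add: well_formed_def)

lemma tail_function_others_tail: "well_formed N \<sigma> \<Longrightarrow> tail_function (others_tail \<sigma> i)"
  unfolding others_tail_def
  using others_nonempty by (intro tail_function_prod_reject_tail) (auto intro: wf_accept)

lemma sets_states_law: "sets (states_law D \<sigma> J) = sets (PiM J (\<lambda>_. state_space))"
  unfolding states_law_def by (rule sets_PiM_state_law)

lemma prob_space_states_law: "well_formed N \<sigma> \<Longrightarrow> J \<subseteq> {1..N} \<Longrightarrow> prob_space (states_law D \<sigma> J)"
  unfolding states_law_def by (rule prob_space_PiM_state_law) (rule wf_accept, assumption, blast)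

lemma continuation_gain_eq:
  assumes "well_formed N \<sigma>" "dominant_strategy_bidding N \<sigma>"
  shows "continuation_gain D N r \<sigma> i v = (if v \<le> r then trade_value (others_tail \<sigma> i) r v - v else 0)"
proof -
  have "continuation_gain D N r \<sigma> i v =
      (if v \<le> r then LBINT x=ereal v..ereal r. (\<Prod>j\<in>{1..N} - {i}. reject_tail D (accept \<sigma> j) x) else 0)"
    unfolding continuation_gain_def states_law_def using assms others_nonempty N
    by (intro integral_rejection_gain wf_accept wf_bid) (auto simp: dominant_strategy_bidding_def)
  then show ?thesis by (simp add: trade_value_def others_tail_def)
qed

text \<open>
  Also for \<open>v > r\<close>, where the interval integral in \<^const>\<open>trade_value\<close> is negative and differs from
  the continuation gain \<open>0\<close>: both comparisons then come out against accepting, since \<open>p \<le> r\<close>.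
\<close>

lemma gain_from_accepting_sgn:
  assumes "well_formed N \<sigma>" "dominant_strategy_bidding N \<sigma>" "0 \<le> v"
  shows "p - v - continuation_gain D N r \<sigma> i v > 0 \<longleftrightarrow> trade_value (others_tail \<sigma> i) r v < p"
    "p - v - continuation_gain D N r \<sigma> i v < 0 \<longleftrightarrow> p < trade_value (others_tail \<sigma> i) r v"
proof -
  interpret g: tail_function "others_tail \<sigma> i" by (rule tail_function_others_tail[OF assms(1)])
  show "p - v - continuation_gain D N r \<sigma> i v > 0 \<longleftrightarrow> trade_value (others_tail \<sigma> i) r v < p"
    "p - v - continuation_gain D N r \<sigma> i v < 0 \<longleftrightarrow> p < trade_value (others_tail \<sigma> i) r v"
    using g.trade_value_less[of r v r] g.trade_value_self[of r] p r
    by (auto simp: continuation_gain_eq[OF assms(1,2)])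
qed

text \<open>Truthfulness is asked only for sizes in {1..N}, the ones that occur. The prescribed bid
  function meets this, as does the constant bid v.\<close>

lemma stage1_payoff_truthful:
  assumes "dominant_strategy_bidding N \<sigma>" "i \<in> {1..N}" "0 \<le> v" "\<And>n. n \<in> {1..N} \<Longrightarrow> \<beta> n = v"
  shows "stage1_payoff D N r p \<sigma> i v q \<beta> = q * (p - v) + (1 - q) * continuation_gain D N r \<sigma> i v"
  unfolding stage1_payoff_def continuation_gain_def assms(4)[OF auction_size_in[OF assms(2)]]
    seller_gain_competing_bids[OF assms(1-3)] ..

lemma integrable_rejection_gain_bid:
  assumes "well_formed N \<sigma>" "prob_space M" "sets M = sets (PiM ({1..N} - {i}) (\<lambda>_. state_space))" "0 \<le> v"
  shows "integrable M (rejection_gain ({1..N} - {i}) r (\<lambda>j u. bid \<sigma> j u N) v)"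
  using assms r N by (intro integrable_rejection_gain) (auto intro: wf_bid)

text \<open>Dominance in each state passes to every belief \<open>M\<close>. The bid may depend on
  the state so that plans contingent on the announced size are included.\<close>

lemma integral_seller_gain_le:
  assumes "well_formed N \<sigma>" "dominant_strategy_bidding N \<sigma>" "i \<in> {1..N}" "0 \<le> v"
    "prob_space M" "sets M = sets (PiM ({1..N} - {i}) (\<lambda>_. state_space))"
  shows "(\<integral>\<omega>. seller_gain r v (\<beta> \<omega>) (competing_bids N \<sigma> i \<omega>) \<partial>M)
    \<le> (\<integral>\<omega>. rejection_gain ({1..N} - {i}) r (\<lambda>j u. bid \<sigma> j u N) v \<omega> \<partial>M)"
proof (rule integral_mono') \<comment> \<open>a non-measurable deviation has the junk integral \<open>0\<close>\<close>
  show "integrable M (rejection_gain ({1..N} - {i}) r (\<lambda>j u. bid \<sigma> j u N) v)"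
    using assms by (intro integrable_rejection_gain_bid)
  show "seller_gain r v (\<beta> \<omega>) (competing_bids N \<sigma> i \<omega>) \<le> rejection_gain ({1..N} - {i}) r (\<lambda>j u. bid \<sigma> j u N) v \<omega>" for \<omega>
    using seller_gain_le_truthful seller_gain_competing_bids[OF assms(2-4)] by metis
qed (rule rejection_gain_nonneg)

lemma stage1_payoff_le:
  assumes "well_formed N \<sigma>" "dominant_strategy_bidding N \<sigma>" "i \<in> {1..N}" "0 \<le> v" "q \<le> 1"
  shows "stage1_payoff D N r p \<sigma> i v q \<beta> \<le> q * (p - v) + (1 - q) * continuation_gain D N r \<sigma> i v"
proof -
  have "prob_space (states_law D \<sigma> ({1..N} - {i}))" using assms(1) by (rule prob_space_states_law) auto
  from integral_seller_gain_le[OF assms(1-4) this sets_states_law] assms(5) show ?thesis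
    unfolding stage1_payoff_def continuation_gain_def by (intro add_left_mono mult_left_mono) auto
qed

subsection \<open>Uniqueness\<close>

lemma equilibrium_accept:
  assumes "perfect_bayesian_equilibrium D N r p \<sigma>" "dominant_strategy_bidding N \<sigma>" "i \<in> {1..N}" "v \<in> {0..1}"
  shows "trade_value (others_tail \<sigma> i) r v < p \<Longrightarrow> accept \<sigma> i v = 1"
    "p < trade_value (others_tail \<sigma> i) r v \<Longrightarrow> accept \<sigma> i v = 0"
proof -
  have wf: "well_formed N \<sigma>" and sr: "sequentially_rational D N r p \<sigma>"
    using assms(1) by (auto simp: perfect_bayesian_equilibrium_def)
  let ?a = "accept \<sigma> i v" and ?c = "continuation_gain D N r \<sigma> i v"
  have a: "?a \<in> {0..1}" using wf assms(3,4) by (simp add: well_formed_def)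
  have v: "0 \<le> v" using assms(4) by simp
  have stage1: "\<forall>i\<in>{1..N}. \<forall>v\<in>{0..1}. \<forall>q\<in>{0..1}. \<forall>\<beta>. (\<forall>n. 0 \<le> \<beta> n) \<longrightarrow>
      stage1_payoff D N r p \<sigma> i v q \<beta> \<le> stage1_payoff D N r p \<sigma> i v (accept \<sigma> i v) (bid \<sigma> i v)"
    using sr unfolding sequentially_rational_def by (rule conjunct1)
  \<comment> \<open>With truthful bids kept fixed the payoff is affine in q, so comparing with the
    two extremes q = 0 and q = 1 determines the sign conditions on the acceptance
    probability.\<close>
  have "q * (p - v) + (1 - q) * ?c \<le> ?a * (p - v) + (1 - ?a) * ?c" if "q \<in> {0..1}" for q
  proof -
    have "stage1_payoff D N r p \<sigma> i v q (\<lambda>_. v) \<le> stage1_payoff D N r p \<sigma> i v ?a (bid \<sigma> i v)"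
      using stage1[rule_format, OF assms(3,4) that] v by simp
    moreover have "stage1_payoff D N r p \<sigma> i v ?a (bid \<sigma> i v) = ?a * (p - v) + (1 - ?a) * ?c"
      using assms by (intro stage1_payoff_truthful) (auto simp: dominant_strategy_bidding_def)
    moreover have "stage1_payoff D N r p \<sigma> i v q (\<lambda>_. v) = q * (p - v) + (1 - q) * ?c"
      using assms by (intro stage1_payoff_truthful) auto
    ultimately show ?thesis by simp
  qed
  from this[of 0] this[of 1] have *: "0 \<le> ?a * (p - v - ?c)" "0 \<le> (?a - 1) * (p - v - ?c)"
    by (simp_all add: algebra_simps)
  show "?a = 1" if "trade_value (others_tail \<sigma> i) r v < p"
    using gain_from_accepting_sgn(1)[OF wf assms(2) v, of i] that *(2) a by (auto simp: zero_le_mult_iff)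
  show "?a = 0" if "p < trade_value (others_tail \<sigma> i) r v"
    using gain_from_accepting_sgn(2)[OF wf assms(2) v, of i] that *(1) a by (auto simp: zero_le_mult_iff)
qed

text \<open>The third claim settles the cutoff type in the corner: if even type 0 strictly prefers
  the auction, the cutoff is 0 and no tie is left there.\<close>

lemma equilibrium_cutoff:
  assumes "perfect_bayesian_equilibrium D N r p \<sigma>" "dominant_strategy_bidding N \<sigma>" "i \<in> {1..N}"
    "is_cutoff (others_tail \<sigma> i) r p t" "v \<in> {0..1}"
  shows "v < t \<Longrightarrow> accept \<sigma> i v = 1" "t < v \<Longrightarrow> accept \<sigma> i v = 0"
    "v = t \<Longrightarrow> p < trade_value (others_tail \<sigma> i) r 0 \<Longrightarrow> accept \<sigma> i v = 0"
proof -
  have wf: "well_formed N \<sigma>" using assms(1) by (auto simp: perfect_bayesian_equilibrium_def)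
  interpret g: tail_function "others_tail \<sigma> i" by (rule tail_function_others_tail[OF wf])
  note less_iff = g.is_cutoff_less_iff[OF assms(4)]
  have t: "0 \<le> t" using assms(4) by (simp add: is_cutoff_def)
  show "accept \<sigma> i v = 1" if "v < t"
    using that less_iff[of v] assms(5) equilibrium_accept(1)[OF assms(1-3,5)] by simp
  show "accept \<sigma> i v = 0" if "t < v"
    using g.trade_value_less[OF t that, of r] g.is_cutoff_ge[OF assms(4)]
      equilibrium_accept(2)[OF assms(1-3,5)] by simp
  show "accept \<sigma> i v = 0" if "v = t" "p < trade_value (others_tail \<sigma> i) r 0"
  proof -
    have "t = 0" using that less_iff[of 0] assms(4) t by (auto simp: is_cutoff_def)
    then show ?thesis using that equilibrium_accept(2)[OF assms(1-3,5)] by simp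
  qed
qed

lemma equilibrium_cutoffs:
  assumes "perfect_bayesian_equilibrium D N r p \<sigma>" "dominant_strategy_bidding N \<sigma>"
  obtains t where "\<And>i. i \<in> {1..N} \<Longrightarrow> is_cutoff (others_tail \<sigma> i) r p t"
    "\<And>i x. i \<in> {1..N} \<Longrightarrow> t \<le> x \<Longrightarrow> others_tail \<sigma> i x = value_tail x"
proof -
  have wf: "well_formed N \<sigma>" using assms(1) by (auto simp: perfect_bayesian_equilibrium_def)
  have "\<exists>t. is_cutoff (others_tail \<sigma> i) r p t" for i
    using tail_function.is_cutoff_exists[OF tail_function_others_tail[OF wf]] p by (metis atLeastAtMost_iff)
  then obtain t where t: "\<And>i. is_cutoff (others_tail \<sigma> i) r p (t i)" by metis
  \<comment> \<open>All types above t j reject, so beyond t j the tail of seller j is that of his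
    value.\<close>
  have tail: "reject_tail D (accept \<sigma> j) x = 1 - cdf D x" if "j \<in> {1..N}" "t j \<le> x" for j x
  proof -
    have "reject_tail D (accept \<sigma> j) x = 1 - cdf D (max x (t j))"
    proof (rule reject_tail_cutoff[OF wf_accept[OF wf that(1)]])
      have "t j \<le> 1" "0 \<le> t j" using t[of j] p r by (auto simp: is_cutoff_def)
      then show "accept \<sigma> j v = 1" if "0 \<le> v" "v < t j" for v
        using equilibrium_cutoff(1)[OF assms \<open>j \<in> {1..N}\<close> t] that by simp
      show "accept \<sigma> j v = 0" if "t j < v" "v \<le> 1" for v
        using equilibrium_cutoff(2)[OF assms \<open>j \<in> {1..N}\<close> t] that \<open>0 \<le> t j\<close> by simp
    qed
    then show ?thesis using that by (simp add: max_absorb1)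
  qed
  have le: "t j \<le> t i" if ij: "i \<in> {1..N}" "j \<in> {1..N}" for i j
  proof (rule ccontr)
    assume "\<not> t j \<le> t i"
    then have less: "t i < t j" by simp
    then have "i \<noteq> j" by auto
    \<comment> \<open>The two products share all factors except that i faces j and j faces i. At x
      \<ge> t j > t i both of these factors equal 1 - F x.\<close>
    have agree: "others_tail \<sigma> i x = others_tail \<sigma> j x" if "t j \<le> x" for x
    proof -
      have "others_tail \<sigma> i x = reject_tail D (accept \<sigma> j) x * (\<Prod>k\<in>{1..N} - {i} - {j}. reject_tail D (accept \<sigma> k) x)"
        unfolding others_tail_def using ij \<open>i \<noteq> j\<close> by (intro prod.remove) auto
      moreover have "others_tail \<sigma> j x = reject_tail D (accept \<sigma> i) x * (\<Prod>k\<in>{1..N} - {j} - {i}. reject_tail D (accept \<sigma> k) x)"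
        unfolding others_tail_def using ij \<open>i \<noteq> j\<close> by (intro prod.remove) auto
      moreover have "{1..N} - {i} - {j} = {1..N} - {j} - {i}" by auto
      ultimately show ?thesis using tail[OF ij(1), of x] tail[OF ij(2), of x] that less by simp
    qed
    interpret g: tail_function "others_tail \<sigma> i" by (rule tail_function_others_tail[OF wf])
    have t0: "0 \<le> t i" "t j \<le> r" using t[of i] t[of j] p by (auto simp: is_cutoff_def)
    have "p \<le> trade_value (others_tail \<sigma> i) r (t i)" by (rule g.is_cutoff_ge[OF t])
    also have "\<dots> < trade_value (others_tail \<sigma> i) r (t j)" by (rule g.trade_value_less[OF t0(1) less])
    also have "\<dots> = trade_value (others_tail \<sigma> j) r (t j)" by (rule trade_value_cong[OF t0(2) agree])
    \<comment> \<open>Here t j > t i \<ge> 0 excludes the corner, so the cutoff condition of j is an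
      equation.\<close>
    also have "\<dots> = p" using t[of j] less t0 by (auto simp: is_cutoff_def split: if_splits)
    finally show False by simp
  qed
  have one: "1 \<in> {1..N}" using N by simp
  have eq: "t i = t 1" if "i \<in> {1..N}" for i using le[OF that one] le[OF one that] by simp
  show thesis
  proof (rule that[of "t 1"])
    show "is_cutoff (others_tail \<sigma> i) r p (t 1)" if "i \<in> {1..N}" for i
      using t[of i] eq[OF that] by simp
    show "others_tail \<sigma> i x = value_tail x" if "i \<in> {1..N}" "t 1 \<le> x" for i x
    proof -
      have "others_tail \<sigma> i x = (\<Prod>j\<in>{1..N} - {i}. 1 - cdf D x)"
        unfolding others_tail_def
      proof (rule prod.cong[OF refl])
        fix j assume "j \<in> {1..N} - {i}"
        then show "reject_tail D (accept \<sigma> j) x = 1 - cdf D x"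
          using tail[of j x] eq[of j] that(2) by auto
      qed
      then show ?thesis using that(1) by (simp add: value_tail_def)
    qed
  qed
qed

end

text \<open>The condition at t sees the tail only beyond t. This replaces the equilibrium-dependent
  tail by the primitive one.\<close>

lemma is_cutoff_cong:
  assumes "p \<le> r" "\<And>x. t \<le> x \<Longrightarrow> g x = h x"
  shows "is_cutoff g r p t \<longleftrightarrow> is_cutoff h r p t"
proof (cases "t \<le> p")
  case True
  then have "trade_value g r t = trade_value h r t"
    using assms by (intro trade_value_cong) auto
  then show ?thesis by (auto simp: is_cutoff_def)
qed (simp add: is_cutoff_def)

section \<open>Identification of the common cutoff with the threshold\<close>

context speculation_game
begin

lemma threshold_equation_iff: "threshold_equation (cdf D) N r p v \<longleftrightarrow> trade_value value_tail r v = p"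
  unfolding threshold_equation_def trade_value_def value_tail_def by linarith

lemma pi0_eq: "pi0 (cdf D) N r = trade_value value_tail r 0"
  by (simp add: pi0_def trade_value_def value_tail_def zero_ereal_def)

text \<open>The trade value at 0 is \<open>pi0\<close>, so \<open>pi0\<close> < p rules out the
  corner. What remains is the range of v: a solution cannot exceed p, because the trade value at p
  is already at least p and grows strictly.\<close>

lemma is_cutoff_threshold_equation:
  assumes "pi0 (cdf D) N r < p"
  shows "v \<in> {0..1} \<and> threshold_equation (cdf D) N r p v \<longleftrightarrow> is_cutoff value_tail r p v"
proof -
  interpret g: tail_function value_tail by (rule tail_function_value_tail)
  have "v \<le> p" if "0 \<le> v" "trade_value value_tail r v = p"
    using that p g.trade_value_less_iff[of p v r] g.le_trade_value[of p r] by force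
  then show ?thesis
    using assms p r by (auto simp: is_cutoff_def threshold_equation_iff pi0_eq split: if_splits)
qed

lemma vstar_exists1:
  assumes "pi0 (cdf D) N r < p"
  shows "\<exists>!v. v \<in> {0..1} \<and> threshold_equation (cdf D) N r p v"
proof -
  interpret g: tail_function value_tail by (rule tail_function_value_tail)
  have "0 \<le> p" "p \<le> r" using p by auto
  then obtain t where "is_cutoff value_tail r p t" by (rule g.is_cutoff_exists)
  then show ?thesis unfolding is_cutoff_threshold_equation[OF assms] using g.is_cutoff_unique by blast
qed

lemma is_cutoff_vstar: "is_cutoff value_tail r p (vstar (cdf D) N r p)"
proof (cases "p \<le> pi0 (cdf D) N r")
  case True
  then show ?thesis using p by (simp add: vstar_def is_cutoff_def pi0_eq)
next
  case False
  then have "pi0 (cdf D) N r < p" by simp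
  note iff = is_cutoff_threshold_equation[OF this] and ex1 = vstar_exists1[OF this]
  have "vstar (cdf D) N r p = (THE v. is_cutoff value_tail r p v)"
    by (simp only: vstar_def False if_False iff)
  then show ?thesis using theI'[OF ex1[unfolded iff]] by simp
qed

lemma equilibrium_is_cutoff_vstar:
  assumes "perfect_bayesian_equilibrium D N r p \<sigma>" "dominant_strategy_bidding N \<sigma>" "i \<in> {1..N}"
  shows "is_cutoff (others_tail \<sigma> i) r p (vstar (cdf D) N r p)"
    "\<And>x. vstar (cdf D) N r p \<le> x \<Longrightarrow> others_tail \<sigma> i x = value_tail x"
proof -
  interpret g: tail_function value_tail by (rule tail_function_value_tail)
  obtain t where t: "\<And>i. i \<in> {1..N} \<Longrightarrow> is_cutoff (others_tail \<sigma> i) r p t"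
    "\<And>i x. i \<in> {1..N} \<Longrightarrow> t \<le> x \<Longrightarrow> others_tail \<sigma> i x = value_tail x"
    using equilibrium_cutoffs[OF assms(1,2)] by metis
  have "is_cutoff value_tail r p t"
    using is_cutoff_cong[of p r t "others_tail \<sigma> i" value_tail] t assms(3) p by simp
  then have "t = vstar (cdf D) N r p" using is_cutoff_vstar by (rule g.is_cutoff_unique)
  with t assms(3) show "is_cutoff (others_tail \<sigma> i) r p (vstar (cdf D) N r p)"
    "\<And>x. vstar (cdf D) N r p \<le> x \<Longrightarrow> others_tail \<sigma> i x = value_tail x" by auto
qed

text \<open>The exception is genuine indifference: for \<open>pi0\<close> \<le> p the trade value at
  the threshold equals p, and every acceptance probability is a best response there. For p <
  \<open>pi0\<close> type 0 strictly prefers the auction.\<close>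

lemma equilibrium_accept_vstar:
  assumes "perfect_bayesian_equilibrium D N r p \<sigma>" "dominant_strategy_bidding N \<sigma>" "i \<in> {1..N}" "v \<in> {0..1}"
  shows "accept \<sigma> i v = (if v < vstar (cdf D) N r p then 1 else 0) \<or>
    (v = vstar (cdf D) N r p \<and> pi0 (cdf D) N r \<le> p)"
proof -
  let ?t = "vstar (cdf D) N r p"
  note cutoff = equilibrium_is_cutoff_vstar[OF assms(1-3)]
  note accept = equilibrium_cutoff[OF assms(1-3) cutoff(1) assms(4)]
  have "accept \<sigma> i v = 0" if "v = ?t" "p < pi0 (cdf D) N r"
  proof -
    have "?t = 0" using that by (simp add: vstar_def)
    then have "trade_value (others_tail \<sigma> i) r 0 = trade_value value_tail r 0"
      using cutoff(2) r by (intro trade_value_cong) auto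
    then show ?thesis using accept(3) that by (simp add: pi0_eq)
  qed
  then show ?thesis using accept(1,2) by (cases v ?t rule: linorder_cases) auto
qed

lemma same_equilibriumI:
  assumes \<sigma>: "perfect_bayesian_equilibrium D N r p \<sigma>" "dominant_strategy_bidding N \<sigma>"
    and \<tau>: "perfect_bayesian_equilibrium D N r p \<tau>" "dominant_strategy_bidding N \<tau>"
    and accept: "\<And>i. i \<in> {1..N} \<Longrightarrow> AE v in D. accept \<sigma> i v = accept \<tau> i v"
  shows "same_equilibrium D N \<sigma> \<tau>"
proof -
  have wf: "well_formed N \<sigma>" "well_formed N \<tau>"
    and cb: "consistent_beliefs D N \<sigma>" "consistent_beliefs D N \<tau>"
    using \<sigma>(1) \<tau>(1) by (auto simp: perfect_bayesian_equilibrium_def)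
  \<comment> \<open>Exact equality of the laws transfers both the condition of positive probability
    and the conditional measure from one equilibrium to the other.\<close>
  have law: "states_law D \<sigma> J = states_law D \<tau> J" if "J \<subseteq> {1..N}" for J
    unfolding states_law_def
  proof (rule PiM_cong[OF refl])
    fix j assume "j \<in> J"
    then have "j \<in> {1..N}" using that by auto
    then show "state_law D (accept \<sigma> j) = state_law D (accept \<tau> j)"
      using wf accept by (intro state_law_cong wf_accept)
  qed
  show ?thesis
    unfolding same_equilibrium_def
  proof (intro conjI ballI allI impI)
    show "AE v in D. accept \<sigma> i v = accept \<tau> i v" if "i \<in> {1..N}" for i
      using that by (rule accept)
    show "seller_belief \<sigma> i v n = seller_belief \<tau> i v n"
      if "i \<in> {1..N}" "v \<in> {0..1}" "n \<in> {1..N}"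
        "0 < measure (states_law D \<sigma> ({1..N} - {i})) (seller_info N i n)" for i v n
    proof -
      have "bayes_belief ({1..N} - {i}) (states_law D \<rho> ({1..N} - {i})) (seller_info N i n) (seller_belief \<rho> i v n)"
        if "consistent_beliefs D N \<rho>" for \<rho>
        using that \<open>i \<in> {1..N}\<close> \<open>v \<in> {0..1}\<close> \<open>n \<in> {1..N}\<close> unfolding consistent_beliefs_def by blast
      from this[OF cb(1)] this[OF cb(2)] show ?thesis
        using that(4) law[of "{1..N} - {i}"] by (simp add: bayes_belief_def)
    qed
    show "spec_belief \<sigma> A = spec_belief \<tau> A"
      if A: "A \<subseteq> {1..N} \<and> A \<noteq> {} \<and> 0 < measure (states_law D \<sigma> {1..N}) (spec_info N A)" for A
    proof -
      have "bayes_belief {1..N} (states_law D \<rho> {1..N}) (spec_info N A) (spec_belief \<rho> A)"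
        if "consistent_beliefs D N \<rho>" for \<rho>
        using that A unfolding consistent_beliefs_def by blast
      from this[OF cb(1)] this[OF cb(2)] show ?thesis
        using A law[of "{1..N}"] by (simp add: bayes_belief_def)
    qed
    show "bid \<sigma> i v n = bid \<tau> i v n" if "i \<in> {1..N}" "v \<in> {0..1}" "n \<in> {1..N}" for i v n
      using that \<sigma>(2) \<tau>(2) by (simp add: dominant_strategy_bidding_def)
    show "spec_bids \<sigma> A = spec_bids \<tau> A" if "A \<subseteq> {1..N} \<and> A \<noteq> {}" for A
      using that \<sigma>(2) \<tau>(2) by (simp add: dominant_strategy_bidding_def)
  qed
qed

end

subsection \<open>Existence\<close>

text \<open>On an information set of probability zero any belief is admissible; a point mass is chosen.\<close>

definition bayes_update ::
  "nat set \<Rightarrow> (nat \<Rightarrow> real \<times> bool) measure \<Rightarrow> (nat \<Rightarrow> real \<times> bool) set \<Rightarrow> (nat \<Rightarrow> real \<times> bool) measure" where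
  "bayes_update J P E =
     (if 0 < measure P E then uniform_measure P E else return (PiM J (\<lambda>_. state_space)) (SOME \<omega>. \<omega> \<in> E))"

lemma bayes_belief_bayes_update:
  assumes "prob_space P" "sets P = sets (PiM J (\<lambda>_. state_space))" "E \<in> sets P" "E \<noteq> {}"
  shows "bayes_belief J P E (bayes_update J P E)"
proof -
  interpret prob_space P by fact
  show ?thesis
  proof (cases "0 < measure P E")
    case True
    then have "emeasure P E \<noteq> 0" "emeasure P E \<noteq> \<infinity>" by (auto simp: emeasure_eq_measure)
    then have "prob_space (uniform_measure P E)" "measure (uniform_measure P E) E = 1"
      using assms(3) True by (auto intro: prob_space_uniform_measure)
    then show ?thesis using True assms(2) by (simp add: bayes_belief_def bayes_update_def)
  next
    case False
    let ?M = "PiM J (\<lambda>_. state_space)"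
    have E: "(SOME \<omega>. \<omega> \<in> E) \<in> E" using assms(4) by (simp add: some_in_eq)
    moreover have "E \<in> sets ?M" using assms by simp
    moreover from this E have "(SOME \<omega>. \<omega> \<in> E) \<in> space ?M" using sets.sets_into_space by blast
    ultimately show ?thesis
      using False by (simp add: bayes_belief_def bayes_update_def prob_space_return measure_return)
  qed
qed

text \<open>The auction size is a cardinality of a random set; measurability comes from a finite
  disjunction over the possible sets K of rejecting sellers.\<close>

lemma seller_info_sets: "seller_info N i n \<in> sets (PiM ({1..N} - {i}) (\<lambda>_. state_space))"
proof -
  define J where "J = {1..N} - {i}"
  have [simp]: "finite J" by (simp add: J_def)
  note [measurable] = measurable_component_state[of "PiM J (\<lambda>_. state_space)" J, OF refl]
  have "{\<omega> \<in> space (PiM J (\<lambda>_. state_space)). (\<forall>j\<in>J. 0 \<le> fst (\<omega> j) \<and> fst (\<omega> j) \<le> 1) \<and>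
      (\<exists>K\<in>Pow J. Suc (card K) = n \<and> (\<forall>j\<in>J. \<not> snd (\<omega> j) \<longleftrightarrow> j \<in> K))} \<in> sets (PiM J (\<lambda>_. state_space))"
    by measurable
  also have "{\<omega> \<in> space (PiM J (\<lambda>_. state_space)). (\<forall>j\<in>J. 0 \<le> fst (\<omega> j) \<and> fst (\<omega> j) \<le> 1) \<and>
      (\<exists>K\<in>Pow J. Suc (card K) = n \<and> (\<forall>j\<in>J. \<not> snd (\<omega> j) \<longleftrightarrow> j \<in> K))} = seller_info N i n"
  proof -
    have "(\<exists>K\<in>Pow J. Suc (card K) = n \<and> (\<forall>j\<in>J. \<not> snd (\<omega> j) \<longleftrightarrow> j \<in> K)) \<longleftrightarrow> auction_size N i \<omega> = n" for \<omega>
    proof -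
      have "K = rejectors J \<omega>" if "K \<in> Pow J" "\<forall>j\<in>J. \<not> snd (\<omega> j) \<longleftrightarrow> j \<in> K" for K
        using that by (auto simp: rejectors_def)
      moreover have "rejectors J \<omega> \<in> Pow J" "\<forall>j\<in>J. \<not> snd (\<omega> j) \<longleftrightarrow> j \<in> rejectors J \<omega>"
        by (auto simp: rejectors_def)
      ultimately show ?thesis unfolding auction_size_def J_def[symmetric] by blast
    qed
    then show ?thesis
      unfolding seller_info_def J_def[symmetric]
      by (auto simp: space_PiM space_pair_measure PiE_iff mem_Times_iff)
  qed
  finally show ?thesis by (simp add: J_def)
qed

lemma spec_info_sets:
  assumes "A \<subseteq> {1..N}"
  shows "spec_info N A \<in> sets (PiM {1..N} (\<lambda>_. state_space))"
proof -
  define J where "J = {1..N}"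
  have [simp]: "finite J" by (simp add: J_def)
  note [measurable] = measurable_component_state[of "PiM J (\<lambda>_. state_space)" J, OF refl]
  have "{\<omega> \<in> space (PiM J (\<lambda>_. state_space)). \<forall>j\<in>J. (0 \<le> fst (\<omega> j) \<and> fst (\<omega> j) \<le> 1) \<and>
      (snd (\<omega> j) \<longleftrightarrow> j \<in> A)} \<in> sets (PiM J (\<lambda>_. state_space))"
    by measurable
  also have "{\<omega> \<in> space (PiM J (\<lambda>_. state_space)). \<forall>j\<in>J. (0 \<le> fst (\<omega> j) \<and> fst (\<omega> j) \<le> 1) \<and>
      (snd (\<omega> j) \<longleftrightarrow> j \<in> A)} = spec_info N A"
    using assms unfolding spec_info_def J_def[symmetric]
    by (auto simp: space_PiM space_pair_measure PiE_iff mem_Times_iff acceptors_def)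
  finally show ?thesis by (simp add: J_def)
qed

lemma seller_info_nonempty:
  assumes "i \<in> {1..N}" "n \<in> {1..N}"
  shows "seller_info N i n \<noteq> {}"
proof -
  define J where "J = {1..N} - {i}"
  have "card J = N - 1" using assms(1) by (simp add: J_def)
  then have "n - 1 \<le> card J" using assms(2) by auto
  \<comment> \<open>Seller i himself is in the auction, so n - 1 of the others have to
    reject.\<close>
  then obtain K where K: "K \<subseteq> J" "card K = n - 1" by (metis obtain_subset_with_card_n)
  define \<omega> where "\<omega> = (\<lambda>j\<in>J. (0 :: real, j \<notin> K))"
  have "rejectors J \<omega> = K" using K by (auto simp: rejectors_def \<omega>_def)
  then have "auction_size N i \<omega> = n" using K assms(2) by (simp add: auction_size_def J_def)
  moreover have "\<omega> \<in> J \<rightarrow>\<^sub>E {0..1} \<times> UNIV" by (auto simp: \<omega>_def)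
  ultimately show ?thesis by (auto simp: seller_info_def J_def)
qed

lemma spec_info_nonempty:
  assumes "A \<subseteq> {1..N}"
  shows "spec_info N A \<noteq> {}"
proof -
  define \<omega> where "\<omega> = (\<lambda>j\<in>{1..N}. (0 :: real, j \<in> A))"
  have "acceptors {1..N} \<omega> = A" using assms by (auto simp: acceptors_def \<omega>_def)
  moreover have "\<omega> \<in> {1..N} \<rightarrow>\<^sub>E {0..1} \<times> UNIV" by (auto simp: \<omega>_def)
  ultimately show ?thesis by (auto simp: spec_info_def)
qed

lemma integrable_speculator_gain_zero_bid:
  assumes "0 \<le> r" "prob_space M" "sets M = sets (PiM J (\<lambda>_. state_space))" "K \<subseteq> J" "finite K"
    "\<And>j. j \<in> K \<Longrightarrow> b j \<in> borel_measurable borel"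
  shows "integrable M (\<lambda>\<omega>. speculator_gain r {#0#} (image_mset (\<lambda>j. b j (fst (\<omega> j))) (mset_set K)))"
proof -
  interpret prob_space M by fact
  have comp: "(\<lambda>\<omega>. b j (fst (\<omega> j))) \<in> borel_measurable M" if "j \<in> K" for j
    using measurable_component_state(1)[OF assms(3)] assms(4,6) that
    by (intro measurable_compose[OF _ assms(6)]) auto
  note [measurable] = comp and [simp] = assms(5)
  \<comment> \<open>The \<open>if\<close> stays because bids may be negative for values outside
    {0..1}; either way the gain lies between 0 and r.\<close>
  have eq: "speculator_gain r {#0#} (image_mset (\<lambda>j. b j (fst (\<omega> j))) (mset_set K)) =
      (if \<forall>j\<in>K. 0 \<le> b j (fst (\<omega> j)) then Min (insert r ((\<lambda>j. b j (fst (\<omega> j))) ` K)) else 0)" for \<omega>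
    using assms(1) by (simp add: speculator_gain_zero_bid)
  have bounds: "0 \<le> speculator_gain r {#0#} (image_mset (\<lambda>j. b j (fst (\<omega> j))) (mset_set K))"
    "speculator_gain r {#0#} (image_mset (\<lambda>j. b j (fst (\<omega> j))) (mset_set K)) \<le> r" for \<omega>
    unfolding eq using assms(1) by auto
  show ?thesis
  proof (rule integrable_const_bound[where B=r])
    show "AE \<omega> in M. norm (speculator_gain r {#0#} (image_mset (\<lambda>j. b j (fst (\<omega> j))) (mset_set K))) \<le> r"
      by (rule AE_I2) (simp only: real_norm_def abs_of_nonneg[OF bounds(1)] bounds(2))
    have [measurable]: "(\<lambda>\<omega>. Min (insert r ((\<lambda>j. b j (fst (\<omega> j))) ` K))) \<in> borel_measurable M"
      by (rule borel_measurable_Min_insert) (auto intro: comp)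
    show "(\<lambda>\<omega>. speculator_gain r {#0#} (image_mset (\<lambda>j. b j (fst (\<omega> j))) (mset_set K))) \<in> borel_measurable M"
      unfolding eq by measurable
  qed
qed

text \<open>\<open>states_law\<close> takes an assessment as argument, which is only being built
  here. It reads nothing but the acceptance rules, so the law is spelled out as \<open>P\<close>,
  and \<open>cutoff_assessment_simps\<close> folds it back.\<close>

definition cutoff_assessment :: "real measure \<Rightarrow> nat \<Rightarrow> real \<Rightarrow> assessment" where
  "cutoff_assessment D N t =
     (let \<alpha> = (\<lambda>v. if v < t then 1 else 0);
          P = (\<lambda>J. PiM J (\<lambda>_. state_law D \<alpha>))
      in \<lparr>accept = (\<lambda>i. \<alpha>), bid = (\<lambda>i v n. v), spec_bids = (\<lambda>A. {#0#}),
          seller_belief = (\<lambda>i v n. bayes_update ({1..N} - {i}) (P ({1..N} - {i})) (seller_info N i n)),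
          spec_belief = (\<lambda>A. bayes_update {1..N} (P {1..N}) (spec_info N A))\<rparr>)"

lemma cutoff_assessment_simps:
  "accept (cutoff_assessment D N t) i v = (if v < t then 1 else 0)"
  "bid (cutoff_assessment D N t) i v n = v"
  "spec_bids (cutoff_assessment D N t) A = {#0#}"
  "seller_belief (cutoff_assessment D N t) i v n =
     bayes_update ({1..N} - {i}) (states_law D (cutoff_assessment D N t) ({1..N} - {i})) (seller_info N i n)"
  "spec_belief (cutoff_assessment D N t) A =
     bayes_update {1..N} (states_law D (cutoff_assessment D N t) {1..N}) (spec_info N A)"
  by (simp_all add: cutoff_assessment_def states_law_def Let_def)

lemma well_formed_cutoff_assessment: "well_formed N (cutoff_assessment D N t)"
proof -
  have "accept (cutoff_assessment D N t) i = (\<lambda>v. if v < t then 1 else 0)" for i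
    by (simp add: fun_eq_iff cutoff_assessment_simps)
  moreover have "1 \<le> card A" if "A \<subseteq> {1..N}" "A \<noteq> {}" for A
    using that finite_subset[OF that(1)] by (simp add: Suc_le_eq card_gt_0_iff)
  ultimately show ?thesis
    unfolding well_formed_def by (simp add: cutoff_assessment_simps)
qed

lemma dominant_strategy_bidding_cutoff_assessment: "dominant_strategy_bidding N (cutoff_assessment D N t)"
  by (simp add: dominant_strategy_bidding_def cutoff_assessment_simps)

section \<open>Equilibrium properties of the cutoff assessment\<close>

context speculation_game
begin

lemma consistent_beliefs_cutoff_assessment: "consistent_beliefs D N (cutoff_assessment D N t)"
proof -
  let ?\<sigma> = "cutoff_assessment D N t"
  have P: "prob_space (states_law D ?\<sigma> J)" if "J \<subseteq> {1..N}" for J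
    using well_formed_cutoff_assessment that by (rule prob_space_states_law)
  have "bayes_belief ({1..N} - {i}) (states_law D ?\<sigma> ({1..N} - {i})) (seller_info N i n) (seller_belief ?\<sigma> i v n)"
    if "i \<in> {1..N}" "n \<in> {1..N}" for i v n
    unfolding cutoff_assessment_simps(4)
    by (rule bayes_belief_bayes_update[OF P sets_states_law _ seller_info_nonempty[OF that]])
      (auto simp: sets_states_law seller_info_sets[simplified])
  moreover have "bayes_belief {1..N} (states_law D ?\<sigma> {1..N}) (spec_info N A) (spec_belief ?\<sigma> A)"
    if "A \<subseteq> {1..N}" for A
    unfolding cutoff_assessment_simps(5) using spec_info_sets[OF that]
    by (intro bayes_belief_bayes_update[OF P sets_states_law _ spec_info_nonempty[OF that]])
      (auto simp: sets_states_law)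
  ultimately show ?thesis unfolding consistent_beliefs_def by blast
qed

lemma sequentially_rational_cutoff_assessment:
  fixes t
  defines "\<sigma> \<equiv> cutoff_assessment D N t"
  assumes cutoff: "is_cutoff value_tail r p t"
  shows "sequentially_rational D N r p \<sigma>"
proof -
  have wf: "well_formed N \<sigma>" and dom: "dominant_strategy_bidding N \<sigma>" and cb: "consistent_beliefs D N \<sigma>"
    unfolding \<sigma>_def by (rule well_formed_cutoff_assessment dominant_strategy_bidding_cutoff_assessment
        consistent_beliefs_cutoff_assessment)+
  have bid: "bid \<sigma> i v n = v" for i v n by (simp add: \<sigma>_def cutoff_assessment_simps)
  have acc: "accept \<sigma> i v = (if v < t then 1 else 0)" for i v by (simp add: \<sigma>_def cutoff_assessment_simps)
  have tail: "others_tail \<sigma> i x = value_tail x" if "i \<in> {1..N}" "t \<le> x" for i x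
  proof -
    have "others_tail \<sigma> i x = (\<Prod>j\<in>{1..N} - {i}. 1 - cdf D x)"
      unfolding others_tail_def
    proof (rule prod.cong[OF refl])
      fix j assume "j \<in> {1..N} - {i}"
      then have "acceptance_rule (accept \<sigma> j)" using wf by (auto intro: wf_accept)
      then have "reject_tail D (accept \<sigma> j) x = 1 - cdf D (max x t)"
        by (rule reject_tail_cutoff) (simp_all add: acc)
      then show "reject_tail D (accept \<sigma> j) x = 1 - cdf D x" using that(2) by (simp add: max_absorb1)
    qed
    then show ?thesis using that(1) by (simp add: value_tail_def)
  qed
  show ?thesis
    unfolding sequentially_rational_def
  proof (intro conjI ballI allI impI)
    show "stage1_payoff D N r p \<sigma> i v q \<beta> \<le> stage1_payoff D N r p \<sigma> i v (accept \<sigma> i v) (bid \<sigma> i v)"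
      if i: "i \<in> {1..N}" and v: "v \<in> {0..1}" and q: "q \<in> {0..1}" for i v q \<beta>
    proof -
      interpret g: tail_function "others_tail \<sigma> i" by (rule tail_function_others_tail[OF wf])
      have "p \<le> r" using p by simp
      then have cut: "is_cutoff (others_tail \<sigma> i) r p t"
        using cutoff tail[OF i] is_cutoff_cong[of p r t "others_tail \<sigma> i" value_tail] by simp
      let ?c = "continuation_gain D N r \<sigma> i v" and ?a = "accept \<sigma> i v"
      have v0: "0 \<le> v" using v by simp
      have "0 \<le> (?a - q) * (p - v - ?c)"
      proof (cases "v < t")
        case True
        then have "0 < p - v - ?c"
          using gain_from_accepting_sgn(1)[OF wf dom v0] g.is_cutoff_less_iff[OF cut v0] by simp
        then show ?thesis using q True by (simp add: acc)
      next
        case False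
        \<comment> \<open>Includes the type v = t, possibly indifferent; the weak inequality is
          enough to make rejection optimal.\<close>
        then have "\<not> 0 < p - v - ?c"
          using gain_from_accepting_sgn(1)[OF wf dom v0] g.is_cutoff_less_iff[OF cut v0] by simp
        then show ?thesis using q False by (simp add: acc mult_nonneg_nonpos)
      qed
      then have "q * (p - v) + (1 - q) * ?c \<le> ?a * (p - v) + (1 - ?a) * ?c"
        by (simp add: algebra_simps)
      moreover have "stage1_payoff D N r p \<sigma> i v q \<beta> \<le> q * (p - v) + (1 - q) * ?c"
        using q by (intro stage1_payoff_le wf dom i v0) auto
      moreover have "stage1_payoff D N r p \<sigma> i v ?a (bid \<sigma> i v) = ?a * (p - v) + (1 - ?a) * ?c"
        by (intro stage1_payoff_truthful dom i v0 bid)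
      ultimately show ?thesis by simp
    qed
    show "stage2_seller_payoff N r \<sigma> i v n b \<le> stage2_seller_payoff N r \<sigma> i v n (bid \<sigma> i v n)"
      if i: "i \<in> {1..N}" and v: "v \<in> {0..1}" and n: "n \<in> {1..N}" for i v n b
    proof -
      have v0: "0 \<le> v" using v by simp
      have "bayes_belief ({1..N} - {i}) (states_law D \<sigma> ({1..N} - {i})) (seller_info N i n) (seller_belief \<sigma> i v n)"
        using cb that unfolding consistent_beliefs_def by blast
      then have "prob_space (seller_belief \<sigma> i v n)"
        "sets (seller_belief \<sigma> i v n) = sets (PiM ({1..N} - {i}) (\<lambda>_. state_space))"
        by (simp_all add: bayes_belief_def)
      \<comment> \<open>Truthful bidding is optimal in each state, so one bound covers beliefs on
        and off the equilibrium path.\<close>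
      from integral_seller_gain_le[OF wf dom i v0 this, of "\<lambda>_. b"] show ?thesis
        unfolding stage2_seller_payoff_def bid seller_gain_competing_bids[OF dom i v0] .
    qed
    show "stage2_spec_payoff N r \<sigma> A B \<le> stage2_spec_payoff N r \<sigma> A (spec_bids \<sigma> A)"
      if A: "A \<subseteq> {1..N} \<and> A \<noteq> {}" and B: "size B \<le> card A \<and> (\<forall>b\<in>#B. 0 \<le> b)" for A B
    proof -
      have "bayes_belief {1..N} (states_law D \<sigma> {1..N}) (spec_info N A) (spec_belief \<sigma> A)"
        using cb A unfolding consistent_beliefs_def by blast
      then have "prob_space (spec_belief \<sigma> A)" "sets (spec_belief \<sigma> A) = sets (PiM {1..N} (\<lambda>_. state_space))"
        by (simp_all add: bayes_belief_def)
      then have int: "integrable (spec_belief \<sigma> A) (\<lambda>\<omega>. speculator_gain r {#0#}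
          (seller_bids \<sigma> ({1..N} - A) (card ({1..N} - A)) \<omega>))"
        unfolding seller_bids_def bid using r by (intro integrable_speculator_gain_zero_bid) auto
      have spec: "spec_bids \<sigma> A = {#0#}" by (simp add: \<sigma>_def cutoff_assessment_simps)
      show ?thesis
        unfolding stage2_spec_payoff_def spec
      proof (rule integral_mono'[OF int])
        fix \<omega>
        let ?C = "seller_bids \<sigma> ({1..N} - A) (card ({1..N} - A)) \<omega>"
        show "speculator_gain r B ?C \<le> speculator_gain r {#0#} ?C"
          using B r by (intro speculator_gain_le_zero_bid) auto
        \<comment> \<open>Covers a deviation whose gain is not integrable, since its integral is
          then 0 by default.\<close>
        show "0 \<le> speculator_gain r {#0#} ?C"
          using speculator_gain_le_zero_bid[of r "{#}" ?C] r by (simp add: speculator_gain_def)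
      qed
    qed
  qed
qed

end

text \<open>Uniqueness can hold only up to the decision of the indifferent type. It is therefore
  expressed twice: almost everywhere through \<open>same_equilibrium\<close>, and for each value in
  the last conjunct with the exceptional type spelled out.\<close>

theorem proposition1:
  fixes N :: nat and F f :: "real \<Rightarrow> real" and D :: "real measure" and r p :: real
  assumes "N \<ge> 2"
    and "f \<in> borel_measurable borel" and "\<And>x. 0 \<le> f x"
    and "D = density lborel (\<lambda>x. ennreal (f x))" and "prob_space D"
    and "F = cdf D"
    and "F 0 = 0" and "F 1 = 1" and "\<And>v. v \<in> {0<..1} \<Longrightarrow> 0 < F v"
    and "r \<in> {0<..1}" and "p \<in> {0..r}"
  shows "(pi0 F N r < p \<longrightarrow> (\<exists>!v. v \<in> {0..1} \<and> threshold_equation F N r p v)) \<and>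
    (\<exists>\<sigma>. perfect_bayesian_equilibrium D N r p \<sigma> \<and> dominant_strategy_bidding N \<sigma> \<and>
       (\<forall>i\<in>{1..N}. \<forall>v\<in>{0..1}. accept \<sigma> i v = (if v < vstar F N r p then 1 else 0)) \<and>
       (\<forall>\<tau>. perfect_bayesian_equilibrium D N r p \<tau> \<and> dominant_strategy_bidding N \<tau> \<longrightarrow>
          same_equilibrium D N \<sigma> \<tau>)) \<and>
    (\<forall>\<sigma>. perfect_bayesian_equilibrium D N r p \<sigma> \<and> dominant_strategy_bidding N \<sigma> \<longrightarrow>
       (\<forall>i\<in>{1..N}. \<forall>v\<in>{0..1}.
          accept \<sigma> i v = (if v < vstar F N r p then 1 else 0) \<or>
          (v = vstar F N r p \<and> pi0 F N r \<le> p)))"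
proof -
  interpret prob_space D by fact
  have sets: "sets D = sets borel" by (simp add: assms(4))
  have "AE v in D. v \<notin> {..0}"
    using assms(6,7) by (intro AE_not_in null_setsI) (auto simp: cdf_def sets emeasure_eq_measure)
  moreover have "AE v in D. v \<in> {..1}"
    using assms(6,8) by (subst AE_in_set_eq_1) (auto simp: cdf_def sets)
  ultimately have supp: "AE v in D. v \<in> {0..1}" by eventually_elim auto
  have point: "measure D {x} = 0" for x
  proof -
    have "AE y in lborel. y \<in> {x} \<longrightarrow> ennreal (f y) = 0"
      using AE_lborel_singleton[of x] by eventually_elim auto
    then have "{x} \<in> null_sets D"
      unfolding assms(4) using assms(2) by (subst null_sets_density_iff) simp_all
    then show ?thesis by (auto simp: measure_def)
  qed
  have pos: "0 < cdf D x" if "0 < x" for x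
  proof -
    \<comment> \<open>Positivity of F is given only on (0, 1]; truncating at 1 extends it to all x >
      0.\<close>
    have "cdf D (min x 1) \<le> cdf D x"
      unfolding cdf_def by (intro finite_measure_mono) (auto simp: sets)
    moreover have "0 < cdf D (min x 1)" using assms(9)[of "min x 1"] that by (simp add: assms(6))
    ultimately show ?thesis by linarith
  qed
  interpret speculation_game D N r p
    by unfold_locales (use sets supp point pos assms in auto)
  define t where "t = vstar F N r p"
  define \<sigma> where "\<sigma> = cutoff_assessment D N t"
  have acc: "accept \<sigma> i v = (if v < t then 1 else 0)" for i v by (simp add: \<sigma>_def cutoff_assessment_simps)
  have cutoff: "is_cutoff value_tail r p t" unfolding t_def assms(6) by (rule is_cutoff_vstar)
  have pbe: "perfect_bayesian_equilibrium D N r p \<sigma>"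
    unfolding perfect_bayesian_equilibrium_def \<sigma>_def
    using well_formed_cutoff_assessment sequentially_rational_cutoff_assessment[OF cutoff]
      consistent_beliefs_cutoff_assessment by blast
  have dom: "dominant_strategy_bidding N \<sigma>"
    unfolding \<sigma>_def by (rule dominant_strategy_bidding_cutoff_assessment)
  have same: "same_equilibrium D N \<sigma> \<tau>"
    if "perfect_bayesian_equilibrium D N r p \<tau>" "dominant_strategy_bidding N \<tau>" for \<tau>
  proof (rule same_equilibriumI[OF pbe dom that])
    fix i assume i: "i \<in> {1..N}"
    \<comment> \<open>The cutoff type is the only one in {0..1} whose decision can differ, and it is
      a null event.\<close>
    show "AE v in D. accept \<sigma> i v = accept \<tau> i v"
      using AE_D AE_neq[of t]
    proof eventually_elim
      fix v assume "v \<in> {0..1}" "v \<noteq> t"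
      then show "accept \<sigma> i v = accept \<tau> i v"
        using equilibrium_accept_vstar[OF that i, of v] by (simp add: acc t_def assms(6))
    qed
  qed
  show ?thesis
    using vstar_exists1 pbe dom acc same equilibrium_accept_vstar
    unfolding assms(6) t_def by blast
qed

end
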